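(* Let $w\in\{+,-\}^r$. Then $$r!\,K_w^{(p,q)}(x)=\sum_{k=1}^{r+1}R_w^{(p,q)}(k)\,B_{r,k}(x).$$ Consequently, if $n=r+1$ and $w=\varepsilon_{n-1}\varepsilon_{n-2}\cdots\varepsilon_1$ with $\varepsilon\in\{+,-\}^{n-1}$, then $$\sum_{\pi\in S_n}p^{\operatorname{rec}_\varepsilon^+(\pi)}q^{\operatorname{rec}_\varepsilon^-(\pi)}=\sum_{k=1}^{n}R_w^{(p,q)}(k)=n!\int_0^1K_w^{(p,q)}(x)\,\mathrm{d}x.$$ In particular, $$n!\,\Omega(P_\varepsilon;t)=t\sum_{k=1}^{n}R_w^{(t,t)}(k).$$
   Context: Here $p,q,t$ are indeterminates and $B_{r,k}(x)=\binom r{k-1}x^{k-1}(1-x)^{r+1-k}$ for $1\le k\le r+1$. The polynomials $K_w^{(p,q)}(x)\in\mathbb Q[p,q][x]$ are defined by $K_\varnothing^{(p,q)}(x)=1$, $K_{+v}^{(p,q)}(x)=xK_v^{(p,q)}(x)+p\int_x^1K_v^{(p,q)}(u)\,\mathrm{d}u$, $K_{-v}^{(p,q)}(x)=(1-x)K_v^{(p,q)}(x)+q\int_0^xK_v^{(p,q)}(u)\,\mathrm{d}u$. Decorated endpoint paths: for $w=w_1\cdots w_r$ and $1\le k\le r+1$, a decorated endpoint path of type $(w,k)$ is a pair $(g,\theta)$, where $g=(g_0,\ldots,g_r)\in[r+1]^{r+1}$ has $g_0=k$, $g_i\ge g_{i-1}$ if $w_i=+$, and $g_i\le g_{i-1}$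 if $w_i=-$. Set $S_+(g)=\{i:w_i=+,\ g_i>g_{i-1}\}$, $S_-(g)=\{i:w_i=-,\ g_i<g_{i-1}\}$, $E(g)=\{i:g_i=g_{i-1}\}$. The decoration $\theta$ assigns to each $i\in E(g)$ a value $\theta_i\in[r+1]$ such that $\theta_i<g_{i-1}$ if $w_i=+$ and $\theta_i>g_{i-1}$ if $w_i=-$, and such that the list consisting of $g_0$, the $g_i$ for $i\in S_+(g)\cup S_-(g)$, and the $\theta_i$ for $i\in E(g)$ is a rearrangement of $[r+1]$. $\mathcal M_w(k)$ is the set of these pairs, and $R_w^{(p,q)}(k)=\sum_{(g,\theta)\in\mathcal M_w(k)}p^{|S_+(g)|}q^{|S_-(g)|}$. Fence: $P_\varepsilon$ is the poset on $\{x_1,\ldots,x_n\}$ that is the transitive closure of $x_i\succ x_{i+1}$ if $\varepsilon_i=+$, and $x_i\prec x_{i+1}$ if $\varepsilon_i=-$. $\Omega(P;t)$ is the polynomial with $\Omega(P;m)=\#\{f:P\to[m]\text{ (weakly) order-preserving}\}$ for positive integers $m$. Greedy records: for $\pi\in S_n$, set $i_0=n$; once $i_j$ is chosen, let $A_j(\pi)$ be the set of $i<i_j$ such that $\pi_i>\pi_{i_j}$ if $\varepsilon_i=+$, and $\pi_i<\pi_{i_j}$ if $\varepsilon_i=-$; stop if it is empty, otherwise $i_{j+1}=\max A_j(\pi)$. With $i_0>\cdots>i_s$ the resulting sequence, $\operatorname{rec}_\varepsilon^{+}(\pi)=\#\{1\le j\le s:\varepsilon_{i_j}=+\}$ and $\operatorname{rec}_\varepsilon^{-}(\pi)=\#\{1\le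 j\le s:\varepsilon_{i_j}=-\}$. *)

theory Defs
  imports
    "HOL-Computational_Algebra.Polynomial"
    "HOL-Combinatorics.Permutations"
    "HOL-Library.FuncSet"
    "HOL-Library.Multiset"
begin

text \<open>
  Words over the two signs are lists and positions are counted from 1, so the letter
  \<open>w\<^sub>i\<close> is \<open>w ! (i - 1)\<close>.
\<close>

datatype sign = Plus | Minus

abbreviation letter :: "sign list \<Rightarrow> nat \<Rightarrow> sign" where
  "letter w i \<equiv> w ! (i - 1)"

text \<open>
  The ring \<open>\<rat>[p,q]\<close> is \<^typ>\<open>rat poly poly\<close> and \<open>\<rat>[p,q][x]\<close> is
  \<^typ>\<open>rat poly poly poly\<close>, with the following indeterminates.
\<close>

definition ind_p :: "rat poly poly" where
  "ind_p = [:[:0, 1:]:]"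

definition ind_q :: "rat poly poly" where
  "ind_q = [:0, 1:]"

definition ind_x :: "'a::comm_ring_1 poly" where
  "ind_x = [:0, 1:]"

definition ind_t :: "rat poly" where
  "ind_t = [:0, 1:]"


subsection \<open>The polynomials \<open>K\<^sub>w\<close>\<close>

text \<open>
  The antiderivative with respect to \<open>x\<close> without constant term. The inner \<^const>\<open>smult\<close>
  divides an element of \<open>\<rat>[p,q]\<close> by the integer \<open>i + 1\<close>.
\<close>

definition antideriv :: "rat poly poly poly \<Rightarrow> rat poly poly poly" where
  "antideriv f = (\<Sum>i\<le>degree f. monom (smult [:1 / of_nat (i + 1):] (coeff f i)) (i + 1))"

text \<open>
  The integral of \<open>f(u)\<close> for \<open>u\<close> from \<open>a\<close> to \<open>b\<close>, for limits \<open>a, b\<close> in \<open>\<rat>[p,q]\<close>,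
  respectively in \<open>\<rat>[p,q][x]\<close>.
\<close>

definition integral_const ::
    "rat poly poly \<Rightarrow> rat poly poly \<Rightarrow> rat poly poly poly \<Rightarrow> rat poly poly" where
  "integral_const a b f = poly (antideriv f) b - poly (antideriv f) a"

definition integral_poly ::
    "rat poly poly poly \<Rightarrow> rat poly poly poly \<Rightarrow> rat poly poly poly \<Rightarrow> rat poly poly poly" where
  "integral_poly a b f = pcompose (antideriv f) b - pcompose (antideriv f) a"

fun K :: "rat poly poly \<Rightarrow> rat poly poly \<Rightarrow> sign list \<Rightarrow> rat poly poly poly" where
  "K p q [] = 1"
| "K p q (Plus # v) = ind_x * K p q v + smult p (integral_poly ind_x 1 (K p q v))"
| "K p q (Minus # v) = (1 - ind_x) * K p q v + smult q (integral_poly 0 ind_x (K p q v))"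

definition bernstein :: "nat \<Rightarrow> nat \<Rightarrow> 'a::comm_ring_1 poly" where
  "bernstein r k = of_nat (r choose (k - 1)) * ind_x ^ (k - 1) * (1 - ind_x) ^ (r + 1 - k)"


subsection \<open>Decorated endpoint paths\<close>

definition S_plus :: "sign list \<Rightarrow> (nat \<Rightarrow> nat) \<Rightarrow> nat set" where
  "S_plus w g = {i \<in> {1..length w}. letter w i = Plus \<and> g i > g (i - 1)}"

definition S_minus :: "sign list \<Rightarrow> (nat \<Rightarrow> nat) \<Rightarrow> nat set" where
  "S_minus w g = {i \<in> {1..length w}. letter w i = Minus \<and> g i < g (i - 1)}"

definition E_set :: "sign list \<Rightarrow> (nat \<Rightarrow> nat) \<Rightarrow> nat set" where
  "E_set w g = {i \<in> {1..length w}. g i = g (i - 1)}"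

text \<open>
  Both \<open>g\<close> and \<open>\<theta>\<close> are extensional functions, so that a pair is determined by the values
  on the index sets. The list that has to be a rearrangement of \<open>[r + 1]\<close> is given by its
  multiset of entries.
\<close>

definition decorated_paths :: "sign list \<Rightarrow> nat \<Rightarrow> ((nat \<Rightarrow> nat) \<times> (nat \<Rightarrow> nat)) set" where
  "decorated_paths w k = (let r = length w in
     {(g, \<theta>). g \<in> {0..r} \<rightarrow>\<^sub>E {1..r + 1}
       \<and> g 0 = k
       \<and> (\<forall>i\<in>{1..r}. letter w i = Plus \<longrightarrow> g i \<ge> g (i - 1))
       \<and> (\<forall>i\<in>{1..r}. letter w i = Minus \<longrightarrow> g i \<le> g (i - 1))
       \<and> \<theta> \<in> E_set w g \<rightarrow>\<^sub>E {1..r + 1}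
       \<and> (\<forall>i\<in>E_set w g. letter w i = Plus \<longrightarrow> \<theta> i < g (i - 1))
       \<and> (\<forall>i\<in>E_set w g. letter w i = Minus \<longrightarrow> \<theta> i > g (i - 1))
       \<and> {#g 0#} + image_mset g (mset_set (S_plus w g \<union> S_minus w g))
           + image_mset \<theta> (mset_set (E_set w g)) = mset_set {1..r + 1}})"

definition R :: "'a::comm_semiring_1 \<Rightarrow> 'a \<Rightarrow> sign list \<Rightarrow> nat \<Rightarrow> 'a" where
  "R p q w k =
     (\<Sum>(g, \<theta>)\<in>decorated_paths w k. p ^ card (S_plus w g) * q ^ card (S_minus w g))"


subsection \<open>Fences and order polynomials\<close>

text \<open>
  The element \<open>x\<^sub>i\<close> of the fence is the number \<open>i\<close>. A pair \<open>(a, b)\<close> in one of the following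
  relations means \<open>x\<^sub>a \<prec> x\<^sub>b\<close>, respectively \<open>x\<^sub>a \<preceq> x\<^sub>b\<close>.
\<close>

definition fence_gen :: "sign list \<Rightarrow> (nat \<times> nat) set" where
  "fence_gen \<epsilon> = {(i + 1, i) |i. i \<in> {1..length \<epsilon>} \<and> letter \<epsilon> i = Plus}
               \<union> {(i, i + 1) |i. i \<in> {1..length \<epsilon>} \<and> letter \<epsilon> i = Minus}"

definition fence_carrier :: "sign list \<Rightarrow> nat set" where
  "fence_carrier \<epsilon> = {1..length \<epsilon> + 1}"

definition fence_order :: "sign list \<Rightarrow> (nat \<times> nat) set" where
  "fence_order \<epsilon> = Id_on (fence_carrier \<epsilon>) \<union> (fence_gen \<epsilon>)\<^sup>+"

definition order_preserving_maps ::
    "'a set \<Rightarrow> ('a \<times> 'a) set \<Rightarrow> nat \<Rightarrow> ('a \<Rightarrow> nat) set" where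
  "order_preserving_maps A le m =
     {f \<in> A \<rightarrow>\<^sub>E {1..m}. monotone_on A (\<lambda>a b. (a, b) \<in> le) (\<le>) f}"

definition order_polynomial :: "'a set \<Rightarrow> ('a \<times> 'a) set \<Rightarrow> rat poly" where
  "order_polynomial A le =
     (THE P. \<forall>m\<ge>1. poly P (of_nat m) = of_nat (card (order_preserving_maps A le m)))"


subsection \<open>Greedy records\<close>

definition greedy_candidates :: "sign list \<Rightarrow> (nat \<Rightarrow> nat) \<Rightarrow> nat \<Rightarrow> nat set" where
  "greedy_candidates \<epsilon> \<pi> i =
     {l \<in> {1..<i}. (letter \<epsilon> l = Plus \<longrightarrow> \<pi> l > \<pi> i) \<and> (letter \<epsilon> l = Minus \<longrightarrow> \<pi> l < \<pi> i)}"

text \<open>The sequence \<open>i\<^sub>0, \<dots>, i\<^sub>s\<close> started at \<open>i\<^sub>0 = i\<close>.\<close>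

function greedy_seq :: "sign list \<Rightarrow> (nat \<Rightarrow> nat) \<Rightarrow> nat \<Rightarrow> nat list" where
  "greedy_seq \<epsilon> \<pi> i =
     (if greedy_candidates \<epsilon> \<pi> i = {} then [i]
      else i # greedy_seq \<epsilon> \<pi> (Max (greedy_candidates \<epsilon> \<pi> i)))"
  by auto

lemma Max_greedy_candidates_less:
  assumes "greedy_candidates \<epsilon> \<pi> i \<noteq> {}"
  shows "Max (greedy_candidates \<epsilon> \<pi> i) < i"
proof -
  have "finite (greedy_candidates \<epsilon> \<pi> i)"
    by (simp add: greedy_candidates_def)
  from Max_in[OF this assms] show ?thesis
    by (simp add: greedy_candidates_def)
qed

termination greedy_seq
  by (relation "Wellfounded.measure (\<lambda>(\<epsilon>, \<pi>, i). i)") (auto simp: Max_greedy_candidates_less)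

declare greedy_seq.simps [simp del]

text \<open>
  The records of sign \<open>s\<close>; the starting index \<open>i\<^sub>0 = n\<close> is not counted.
\<close>

definition greedy_records :: "sign \<Rightarrow> sign list \<Rightarrow> (nat \<Rightarrow> nat) \<Rightarrow> nat" where
  "greedy_records s \<epsilon> \<pi> = (let is = greedy_seq \<epsilon> \<pi> (length \<epsilon> + 1) in
     card {j. 1 \<le> j \<and> j < length is \<and> letter \<epsilon> (is ! j) = s})"

end

theory Submission
  imports Defs "HOL-Combinatorics.Multiset_Permutations"
begin

text \<open>
  All the sums in the theorem are governed by one recursion. Given a finite set \<open>A\<close> with a marked
  element \<open>k\<close> and a word \<open>w\<close> of length \<open>card A - 1\<close>, read the first letter, say \<open>+\<close>. Either \<open>k\<close> is
  deleted and the mark moves to a larger element, with weight \<open>p\<close>, or a smaller element is deleted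
  and the mark stays. For \<open>-\<close> the roles of larger and smaller are exchanged and the weight is \<open>q\<close>. The
  total weight of all ways to do this is \<open>deletion_sum p q w A k\<close>.

  A decorated endpoint path is such a process: the marks are its endpoints, and the decorations
  are the elements deleted while the mark stays; the rearrangement condition says that every
  element is used once (\<open>R_eq_deletion_sum\<close>). A permutation scanned greedily from its last entry
  \<open>k\<close> is also such a process: the neighbour on the left is either the next record, and \<open>k\<close> is
  left behind, or it is skipped, and the remaining entries are as if it had been deleted
  (\<open>sum_record_weight\<close>). This gives the equality with the generating function of greedy records.

  The recursion compares elements only, so it may be relabelled to initial segments of the
  natural numbers. There it reads, for \<open>w = + v\<close>,
  \<open>d w k = p * (\<Sum>l\<ge>k. d v l) + (k - 1) * d v (k - 1)\<close>, and this is how the operator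
  \<open>f \<mapsto> x * f + p * \<integral>\<^sub>x\<^sup>1 f\<close> acts on coefficients in the Bernstein basis, up to the
  factor absorbed by \<open>r!\<close>; the other sign is similar (\<open>K_bernstein_expansion\<close>). The integral formula
  follows, since each Bernstein polynomial of degree \<open>r\<close> has integral \<open>1 / (r + 1)\<close>.

  For the order polynomial, let \<open>N w a\<close> be the number of monotone maps into \<open>[m]\<close> with value \<open>a\<close> at
  \<open>x\<^sub>n\<close>. It satisfies \<open>N (+ v) a = (\<Sum>b\<ge>a. N v b)\<close> and \<open>N (- v) a = (\<Sum>b\<le>a. N v b)\<close>. Write
  \<open>N w a = (\<Sum>j. c j * binomial(a - 1, j))\<close> with coefficients \<open>c j\<close> polynomial in \<open>m\<close>. Then
  \<open>K w = (\<Sum>j. c j * binomial(t - 1, j) * x ^ j)\<close> for \<open>p = q = t\<close>, with the \<open>c j\<close> taken at \<open>t\<close>: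
  on this basis the two integral operators act exactly as the two summations (\<open>coeff_K_diagonal\<close>). Finally
  \<open>(\<Sum>a=1..t. binomial(a - 1, j)) = binomial(t, j + 1) = t * \<integral>\<^sub>0\<^sup>1 binomial(t - 1, j) * x ^ j\<close>,
  so the order polynomial is \<open>t\<close> times the integral of \<open>K w\<close>.
\<close>

section \<open>The deletion recursion\<close>

text \<open>
  The direction that a letter allows. The same relation describes a step of an endpoint path,
  the admissible side for a decoration (which advances towards the current endpoint), and the
  comparison that makes an entry a greedy record. Its negation is the inequality between two
  neighbours of the fence.
\<close>

fun advances :: "sign \<Rightarrow> 'a::linorder \<Rightarrow> 'a \<Rightarrow> bool" where
  "advances Plus x y \<longleftrightarrow> x < y"
| "advances Minus x y \<longleftrightarrow> y < x"

fun sign_weight :: "'a \<Rightarrow> 'a \<Rightarrow> sign \<Rightarrow> 'a" where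
  "sign_weight p q Plus = p"
| "sign_weight p q Minus = q"

text \<open>
  A letter either moves the marked element \<open>k\<close> of \<open>A\<close> forward to some \<open>l\<close>, which costs a factor
  \<open>p\<close> or \<open>q\<close> and deletes the old position, or keeps \<open>k\<close> and deletes an element from which \<open>k\<close> is
  reachable. This is the common recursion of decorated paths and of greedy records.
  Working with arbitrary sets \<open>A\<close> postpones every relabelling of values.
\<close>

fun deletion_sum :: "'a::comm_semiring_1 \<Rightarrow> 'a \<Rightarrow> sign list \<Rightarrow> 'b::linorder set \<Rightarrow> 'b \<Rightarrow> 'a" where
  "deletion_sum p q [] A k = 1"
| "deletion_sum p q (a # v) A k =
     sign_weight p q a * (\<Sum>l\<in>{l\<in>A. advances a k l}. deletion_sum p q v (A - {k}) l)
     + (\<Sum>j\<in>{j\<in>A. advances a j k}. deletion_sum p q v (A - {j}) k)"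

lemma advances_irrefl [simp]: "\<not> advances a x x"
  by (cases a) auto

lemma advances_strict_mono_on:
  assumes "strict_mono_on A f" "x \<in> A" "y \<in> A"
  shows "advances a (f x) (f y) \<longleftrightarrow> advances a x y"
  using assms by (cases a) (auto simp: strict_mono_on_less)

text \<open>
  The recursion only compares elements, so the sum depends on the size of \<open>A\<close> and the rank of \<open>k\<close>
  in it alone. This single invariance replaces the standardisation bijections for paths and for permutations.
\<close>

lemma deletion_sum_strict_mono_on:
  assumes "strict_mono_on A f" "k \<in> A"
  shows "deletion_sum p q w (f ` A) (f k) = deletion_sum p q w A k"
  using assms
proof (induction w arbitrary: A k)
  case (Cons a v)
  \<comment> \<open>As \<open>f\<close> is injective on \<open>A\<close>, deleting commutes with relabelling.\<close>
  have inj: "inj_on f A"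
    using Cons.prems(1) by (rule strict_mono_on_imp_inj_on)
  have IH: "deletion_sum p q v (f ` A - {f j}) (f l) = deletion_sum p q v (A - {j}) l"
    if "j \<in> A" "l \<in> A" "l \<noteq> j" for j l
  proof -
    have "f ` A - {f j} = f ` (A - {j})"
      using inj that by (auto simp: inj_on_def)
    moreover have "strict_mono_on (A - {j}) f"
      using Cons.prems(1) by (auto simp: monotone_on_def)
    ultimately show ?thesis
      using Cons.IH[of "A - {j}" l] that by simp
  qed
  have *: "{l \<in> f ` A. advances a (f k) l} = f ` {l \<in> A. advances a k l}"
    "{j \<in> f ` A. advances a j (f k)} = f ` {j \<in> A. advances a j k}"
    using advances_strict_mono_on[OF Cons.prems(1)] Cons.prems(2) by blast+
  have inj': "inj_on f {l \<in> A. advances a k l}" "inj_on f {j \<in> A. advances a j k}"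
    using inj by (auto intro: inj_on_subset)
  have 1: "(\<Sum>l\<in>{l \<in> f ` A. advances a (f k) l}. deletion_sum p q v (f ` A - {f k}) l)
      = (\<Sum>l\<in>{l\<in>A. advances a k l}. deletion_sum p q v (A - {k}) l)"
    unfolding * sum.reindex[OF inj'(1)] o_def
  proof (intro sum.cong refl)
    fix x assume "x \<in> {l \<in> A. advances a k l}"
    then show "deletion_sum p q v (f ` A - {f k}) (f x) = deletion_sum p q v (A - {k}) x"
      using IH[of k x] Cons.prems(2) by (cases "x = k") auto
  qed
  have 2: "(\<Sum>j\<in>{j \<in> f ` A. advances a j (f k)}. deletion_sum p q v (f ` A - {j}) (f k))
      = (\<Sum>j\<in>{j\<in>A. advances a j k}. deletion_sum p q v (A - {j}) k)"
    unfolding * sum.reindex[OF inj'(2)] o_def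
  proof (intro sum.cong refl)
    fix x assume "x \<in> {j \<in> A. advances a j k}"
    then show "deletion_sum p q v (f ` A - {f x}) (f k) = deletion_sum p q v (A - {x}) k"
      using IH[of x k] Cons.prems(2) by (cases "x = k") auto
  qed
  show ?case
    by (simp add: 1 2)
qed simp

lemma image_skip:
  fixes j :: nat
  assumes "j \<in> {1..Suc n}"
  shows "(\<lambda>x. if x < j then x else Suc x) ` {1..n} = {1..Suc n} - {j}" (is "?f ` _ = _")
proof
  show "{1..Suc n} - {j} \<subseteq> ?f ` {1..n}"
  proof
    fix x assume x: "x \<in> {1..Suc n} - {j}"
    show "x \<in> ?f ` {1..n}"
    proof (cases "x < j")
      case True
      then show ?thesis using x assms by (intro image_eqI[of _ _ x]) auto
    next
      case False
      then show ?thesis using x assms by (intro image_eqI[of _ _ "x - 1"]) auto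
    qed
  qed
qed (use assms in auto)

lemma deletion_sum_skip:
  fixes j :: nat
  assumes "j \<in> {1..Suc n}" "k \<in> {1..n}"
  shows "deletion_sum p q v ({1..Suc n} - {j}) (if k < j then k else Suc k)
    = deletion_sum p q v {1..n} k"
proof -
  have "strict_mono_on {1..n} (\<lambda>x. if x < j then x else Suc x)"
    by (auto simp: monotone_on_def)
  from deletion_sum_strict_mono_on[OF this assms(2)] show ?thesis
    unfolding image_skip[OF assms(1)] .
qed

lemma deletion_sum_delete_less:
  fixes k :: nat
  assumes "j \<in> {1..Suc n}" "k \<in> {1..Suc n}" "j < k"
  shows "deletion_sum p q v ({1..Suc n} - {j}) k = deletion_sum p q v {1..n} (k - 1)"
  using deletion_sum_skip[of j n "k - 1" p q v] assms by (cases k) auto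

lemma deletion_sum_delete_greater:
  fixes k :: nat
  assumes "j \<in> {1..Suc n}" "k \<in> {1..Suc n}" "k < j"
  shows "deletion_sum p q v ({1..Suc n} - {j}) k = deletion_sum p q v {1..n} k"
  using deletion_sum_skip[of j n k p q v] assms by auto

text \<open>
  Once the set with a hole is relabelled to an initial segment, all the elements that may be
  deleted while \<open>k\<close> stays give the same value, whence the factors \<open>k - 1\<close> here and
  \<open>n + 1 - k\<close> for the other sign.
\<close>

lemma deletion_sum_Plus:
  fixes k :: nat
  assumes "k \<in> {1..Suc n}"
  shows "deletion_sum p q (Plus # v) {1..Suc n} k =
    p * (\<Sum>l=k..n. deletion_sum p q v {1..n} l) + of_nat (k - 1) * deletion_sum p q v {1..n} (k - 1)"
proof -
  have "(\<Sum>l\<in>{l\<in>{1..Suc n}. k < l}. deletion_sum p q v ({1..Suc n} - {k}) l)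
      = (\<Sum>l=k..n. deletion_sum p q v {1..n} l)"
    using assms
    by (intro sum.reindex_bij_witness[of _ Suc "\<lambda>l. l - 1"])
       (auto simp: deletion_sum_delete_less simp del: One_nat_def)
  moreover have "(\<Sum>j\<in>{j\<in>{1..Suc n}. j < k}. deletion_sum p q v ({1..Suc n} - {j}) k)
      = (\<Sum>j\<in>{j\<in>{1..Suc n}. j < k}. deletion_sum p q v {1..n} (k - 1))"
    using assms by (intro sum.cong refl) (auto simp: deletion_sum_delete_less simp del: One_nat_def)
  moreover have "{j\<in>{1..Suc n}. j < k} = {1..<k}"
    using assms by auto
  ultimately show ?thesis
    by simp
qed

lemma deletion_sum_Minus:
  fixes k :: nat
  assumes "k \<in> {1..Suc n}"
  shows "deletion_sum p q (Minus # v) {1..Suc n} k =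
    q * (\<Sum>l=1..<k. deletion_sum p q v {1..n} l) + of_nat (Suc n - k) * deletion_sum p q v {1..n} k"
proof -
  have "(\<Sum>l\<in>{l\<in>{1..Suc n}. l < k}. deletion_sum p q v ({1..Suc n} - {k}) l)
      = (\<Sum>l=1..<k. deletion_sum p q v {1..n} l)"
    using assms
    by (intro sum.cong) (auto simp: deletion_sum_delete_greater simp del: One_nat_def)
  moreover have "(\<Sum>j\<in>{j\<in>{1..Suc n}. k < j}. deletion_sum p q v ({1..Suc n} - {j}) k)
      = (\<Sum>j\<in>{j\<in>{1..Suc n}. k < j}. deletion_sum p q v {1..n} k)"
    using assms by (intro sum.cong refl) (auto simp: deletion_sum_delete_greater simp del: One_nat_def)
  moreover have "{j\<in>{1..Suc n}. k < j} = {k<..Suc n}"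
    using assms by auto
  ultimately show ?thesis
    by simp
qed


section \<open>Decorated endpoint paths\<close>

definition step_set :: "sign list \<Rightarrow> (nat \<Rightarrow> 'b::linorder) \<Rightarrow> nat set" where
  "step_set w g = {i \<in> {1..length w}. advances (letter w i) (g (i - 1)) (g i)}"

text \<open>
  Decorated paths with values in any set \<open>A\<close>, as needed after a deletion. The multiset condition
  encodes the bounds on the values too: it forces the values used into \<open>A\<close>, and each \<open>g i\<close> is the
  last new value. Weak monotonicity in the allowed directions says that each index is a stay or
  a step.
\<close>

definition paths_in :: "sign list \<Rightarrow> nat set \<Rightarrow> nat \<Rightarrow> ((nat \<Rightarrow> nat) \<times> (nat \<Rightarrow> nat)) set" where
  "paths_in w A k =
     {(g, \<theta>). g \<in> extensional {0..length w} \<and> \<theta> \<in> extensional (E_set w g)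
       \<and> g 0 = k
       \<and> E_set w g \<union> step_set w g = {1..length w}
       \<and> (\<forall>i\<in>E_set w g. advances (letter w i) (\<theta> i) (g (i - 1)))
       \<and> {#g 0#} + image_mset g (mset_set (step_set w g)) + image_mset \<theta> (mset_set (E_set w g))
         = mset_set A}"

lemma step_set_eq: "step_set w g = S_plus w g \<union> S_minus w g"
proof -
  have "advances a x y \<longleftrightarrow> (a = Plus \<and> x < y) \<or> (a = Minus \<and> y < x)" for a and x y :: nat
    by (cases a) auto
  then show ?thesis
    by (auto simp: step_set_def S_plus_def S_minus_def)
qed

text \<open>
  The only point beyond rewriting is that the ranges of \<open>g\<close> and \<open>\<theta>\<close> follow from the rearrangement
  condition: a stay repeats the previous endpoint, and every other value occurs in the list.
\<close>

lemma decorated_paths_eq_paths_in: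
  "decorated_paths w k = paths_in w {1..length w + 1} k"
proof -
  let ?r = "length w"
  have fin: "finite (step_set w g)" "finite (E_set w g)" for g
    by (simp_all add: step_set_def E_set_def)
  have mono: "(\<forall>i\<in>{1..?r}. letter w i = Plus \<longrightarrow> g i \<ge> g (i - 1)) \<and>
       (\<forall>i\<in>{1..?r}. letter w i = Minus \<longrightarrow> g i \<le> g (i - 1))
     \<longleftrightarrow> E_set w g \<union> step_set w g = {1..?r}" for g
  proof -
    have "(a = Plus \<longrightarrow> x \<le> y) \<and> (a = Minus \<longrightarrow> y \<le> x) \<longleftrightarrow> y = x \<or> advances a x y"
      for a and x y :: nat
      by (cases a) auto
    then show ?thesis
      unfolding step_set_def E_set_def by blast
  qed
  have deco: "(\<forall>i\<in>E_set w g. letter w i = Plus \<longrightarrow> \<theta> i < g (i - 1)) \<and>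
       (\<forall>i\<in>E_set w g. letter w i = Minus \<longrightarrow> \<theta> i > g (i - 1))
     \<longleftrightarrow> (\<forall>i\<in>E_set w g. advances (letter w i) (\<theta> i) (g (i - 1)))" for g \<theta>
  proof -
    have "(a = Plus \<longrightarrow> x < y) \<and> (a = Minus \<longrightarrow> y < x) \<longleftrightarrow> advances a x y"
      for a and x y :: nat
      by (cases a) auto
    then show ?thesis by blast
  qed
  have range: "g ` {0..?r} \<subseteq> {1..?r + 1} \<and> \<theta> ` E_set w g \<subseteq> {1..?r + 1}"
    if un: "E_set w g \<union> step_set w g = {1..?r}"
    and ms: "{#g 0#} + image_mset g (mset_set (step_set w g)) + image_mset \<theta> (mset_set (E_set w g))
         = mset_set {1..?r + 1}" for g \<theta>
  proof -
    have vals: "insert (g 0) (g ` step_set w g \<union> \<theta> ` E_set w g) = {1..?r + 1}"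
      using arg_cong[OF ms, of set_mset] fin by simp
    have "g i \<in> {1..?r + 1}" if "i \<le> ?r" for i
      using that
    proof (induction i)
      case 0
      then show ?case using vals by blast
    next
      case (Suc i)
      then have "Suc i \<in> E_set w g \<or> Suc i \<in> step_set w g"
        using un by auto
      then show ?case
      proof
        assume "Suc i \<in> E_set w g"
        then show ?thesis using Suc by (simp add: E_set_def)
      next
        assume "Suc i \<in> step_set w g"
        then show ?thesis using vals by blast
      qed
    qed
    then show ?thesis using vals by auto
  qed
  show ?thesis
  proof (intro set_eqI, clarify)
    fix g \<theta> :: "nat \<Rightarrow> nat"
    show "(g, \<theta>) \<in> decorated_paths w k \<longleftrightarrow> (g, \<theta>) \<in> paths_in w {1..?r + 1} k"
      unfolding decorated_paths_def paths_in_def Let_def mem_Collect_eq prod.case PiE_iff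
        step_set_eq[symmetric]
      using mono[of g] deco[of g \<theta>] range[of g \<theta>] by (auto simp del: atLeastAtMost_iff)
  qed
qed

lemma upto_length_Cons: "{1..length (a # v)} = insert 1 (Suc ` {1..length v})"
proof -
  have "{1..Suc n} = insert 1 {Suc 1..Suc n}" for n by auto
  then show ?thesis unfolding image_Suc_atLeastAtMost by simp
qed

lemma Collect_upto_length_Cons:
  "{i \<in> {1..length (a # v)}. P i} = (if P 1 then {1} else {}) \<union> Suc ` {i \<in> {1..length v}. P (Suc i)}"
proof -
  have "{i \<in> insert 1 (Suc ` X). P i} = (if P 1 then {1} else {}) \<union> Suc ` {i \<in> X. P (Suc i)}" for X
    by auto
  then show ?thesis
    unfolding upto_length_Cons .
qed

lemma E_set_Cons:
  "E_set (a # v) g = (if g 1 = g 0 then {1} else {}) \<union> Suc ` E_set v (g \<circ> Suc)"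
proof -
  have "{i \<in> {1..length v}. g (Suc i) = g (Suc i - 1)} = E_set v (g \<circ> Suc)"
    unfolding E_set_def by (intro Collect_cong) auto
  then show ?thesis
    unfolding E_set_def[of "a # v"] Collect_upto_length_Cons by simp
qed

lemma step_set_Cons:
  "step_set (a # v) g = (if advances a (g 0) (g 1) then {1} else {}) \<union> Suc ` step_set v (g \<circ> Suc)"
proof -
  have "{i \<in> {1..length v}. advances (letter (a # v) (Suc i)) (g (Suc i - 1)) (g (Suc i))}
      = step_set v (g \<circ> Suc)"
    unfolding step_set_def by (intro Collect_cong) (auto simp: nth_Cons')
  then show ?thesis
    unfolding step_set_def[of "a # v"] Collect_upto_length_Cons by simp
qed

lemma zero_notin_E_set_step_set [simp]: "0 \<notin> E_set w g" "0 \<notin> step_set w g"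
  by (auto simp: E_set_def step_set_def)

lemma finite_E_set_step_set [simp]: "finite (E_set w g)" "finite (step_set w g)"
  by (auto simp: E_set_def step_set_def)

lemma mset_set_insert_1_image_Suc:
  assumes "finite X" "0 \<notin> X"
  shows "image_mset f (mset_set ({1} \<union> Suc ` X)) = {#f 1#} + image_mset (f \<circ> Suc) (mset_set X)"
    and "image_mset f (mset_set (Suc ` X)) = image_mset (f \<circ> Suc) (mset_set X)"
proof -
  show *: "image_mset f (mset_set (Suc ` X)) = image_mset (f \<circ> Suc) (mset_set X)"
    by (simp add: image_mset_mset_set[symmetric] multiset.map_comp)
  have "1 \<notin> Suc ` X"
    using assms(2) by auto
  then show "image_mset f (mset_set ({1} \<union> Suc ` X)) = {#f 1#} + image_mset (f \<circ> Suc) (mset_set X)"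
    using assms(1) unfolding *[symmetric] by simp
qed

text \<open>
  Dropping the first letter shifts both functions. The value of \<open>\<theta>\<close> at the old index 1 lands on
  index 0, where an extensional function on positive indices has to be \<open>undefined\<close>.
\<close>

abbreviation tail_path :: "(nat \<Rightarrow> nat) \<times> (nat \<Rightarrow> nat) \<Rightarrow> (nat \<Rightarrow> nat) \<times> (nat \<Rightarrow> nat)" where
  "tail_path \<equiv> \<lambda>(g, \<theta>). (g \<circ> Suc, (\<theta> \<circ> Suc)(0 := undefined))"

lemma extensional_insert_1_image_Suc:
  assumes "0 \<notin> E"
  shows "\<theta> \<in> extensional ((if b then {1} else {}) \<union> Suc ` E) \<longleftrightarrow>
    \<theta> 0 = undefined \<and> (b \<or> \<theta> 1 = undefined) \<and> (\<theta> \<circ> Suc)(0 := undefined) \<in> extensional E"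
proof -
  have split: "(\<forall>n. P n) \<longleftrightarrow> P 0 \<and> P 1 \<and> (\<forall>n. P (Suc (Suc n)))" for P :: "nat \<Rightarrow> bool"
    by (metis One_nat_def not0_implies_Suc)
  have split': "(\<forall>n. P n) \<longleftrightarrow> P 0 \<and> (\<forall>n. P (Suc n))" for P :: "nat \<Rightarrow> bool"
    by (metis not0_implies_Suc)
  show ?thesis
    unfolding extensional_def mem_Collect_eq
    by (subst split, subst (2) split') (use assms in auto)
qed

lemma single_plus_eq_mset_set_iff:
  assumes "finite A"
  shows "{#x#} + M = mset_set A \<longleftrightarrow> x \<in> A \<and> M = mset_set (A - {x})"
proof
  assume *: "{#x#} + M = mset_set A"
  then have "x \<in> A"
    using assms by (metis finite_set_mset_mset_set insertI1 set_mset_add_mset_insert union_commute add_mset_add_single)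
  then show "x \<in> A \<and> M = mset_set (A - {x})"
    using * assms by (metis add_diff_cancel_left' mset_set.remove add_mset_add_single union_commute)
next
  assume "x \<in> A \<and> M = mset_set (A - {x})"
  then show "{#x#} + M = mset_set A"
    using assms by (metis add_mset_add_single mset_set.remove union_commute)
qed

text \<open>
  If the first letter is a step, \<open>k\<close> occurs in the list only as the entry \<open>g 0\<close>, and the tail
  uses \<open>A - {k}\<close>. If it is a stay, the tail still starts at \<open>k\<close> and contributes the entry \<open>k\<close>
  itself, so what is used up is the decoration \<open>\<theta> 1\<close>.
\<close>

lemma paths_in_Cons_iff:
  assumes "finite A"
  shows "(g, \<theta>) \<in> paths_in (a # v) A k \<longleftrightarrow> g 0 = k \<and> \<theta> 0 = undefined \<and>
    ((advances a k (g 1) \<and> \<theta> 1 = undefined \<and> k \<in> A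
        \<and> tail_path (g, \<theta>) \<in> paths_in v (A - {k}) (g 1))
     \<or> (g 1 = k \<and> advances a (\<theta> 1) k \<and> \<theta> 1 \<in> A
        \<and> tail_path (g, \<theta>) \<in> paths_in v (A - {\<theta> 1}) k))"
proof -
  let ?g = "g \<circ> Suc" and ?t = "(\<theta> \<circ> Suc)(0 := undefined)"
  have extg: "g \<in> extensional {0..length (a # v)} \<longleftrightarrow> ?g \<in> extensional {0..length v}"
  proof -
    have "(\<forall>x. x > Suc (length v) \<longrightarrow> g x = undefined) \<longleftrightarrow> (\<forall>x. x > length v \<longrightarrow> g (Suc x) = undefined)"
      using Suc_less_eq2 by auto
    then show ?thesis
      by (simp add: extensional_def not_le)
  qed
  have imt: "image_mset ?t (mset_set (E_set v ?g)) = image_mset (\<theta> \<circ> Suc) (mset_set (E_set v ?g))"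
    by (intro image_mset_cong) (auto intro!: fun_upd_other)
  have deco: "(\<forall>i\<in>Suc ` E_set v ?g. advances (letter (a # v) i) (\<theta> i) (g (i - 1)))
      \<longleftrightarrow> (\<forall>i\<in>E_set v ?g. advances (letter v i) (?t i) (?g (i - 1)))"
  proof -
    have "advances (letter (a # v) (Suc i)) (\<theta> (Suc i)) (g (Suc i - 1))
        \<longleftrightarrow> advances (letter v i) (?t i) (?g (i - 1))" if "i \<in> E_set v ?g" for i
    proof -
      have "i \<noteq> 0" using that by (metis zero_notin_E_set_step_set(1))
      then show ?thesis by (simp add: nth_Cons')
    qed
    then show ?thesis by simp
  qed
  have cover: "X \<union> Suc ` S = {1..length (a # v)} \<longleftrightarrow> 1 \<in> X \<and> S = {1..length v}"
    if "X \<subseteq> {1}" "0 \<notin> S" for X S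
  proof -
    have notin: "1 \<notin> Suc ` S" "1 \<notin> Suc ` {1..length v}"
      using that(2) by auto
    from that(1) consider "X = {}" | "X = {1}" by blast
    then show ?thesis
    proof cases
      case 1
      then show ?thesis using notin(1) unfolding upto_length_Cons by blast
    next
      case 2
      then show ?thesis
        using insert_ident[OF notin] inj_image_eq_iff[OF inj_Suc, of S "{1..length v}"]
        unfolding upto_length_Cons by blast
    qed
  qed
  show ?thesis
  proof (cases "advances a (g 0) (g 1)")
    case True
    then have ne: "g 1 \<noteq> g 0" by auto
    with True have sets: "E_set (a # v) g = (if False then {1} else {}) \<union> Suc ` E_set v ?g"
      "step_set (a # v) g = {1} \<union> Suc ` step_set v ?g"
      by (simp_all only: E_set_Cons step_set_Cons if_True if_False Un_empty_left)
    have ext: "\<theta> \<in> extensional (E_set (a # v) g)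
        \<longleftrightarrow> \<theta> 0 = undefined \<and> \<theta> 1 = undefined \<and> ?t \<in> extensional (E_set v ?g)"
      unfolding sets(1) using extensional_insert_1_image_Suc[of "E_set v ?g" \<theta> False] by simp
    have cov: "E_set (a # v) g \<union> step_set (a # v) g = {1..length (a # v)}
        \<longleftrightarrow> E_set v ?g \<union> step_set v ?g = {1..length v}"
      using cover[of "{1}" "E_set v ?g \<union> step_set v ?g"] unfolding sets by (auto simp: Un_ac)
    have dec: "(\<forall>i\<in>E_set (a # v) g. advances (letter (a # v) i) (\<theta> i) (g (i - 1)))
        \<longleftrightarrow> (\<forall>i\<in>E_set v ?g. advances (letter v i) (?t i) (?g (i - 1)))"
      unfolding sets using deco by simp
    have ms: "{#g 0#} + image_mset g (mset_set (step_set (a # v) g))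
           + image_mset \<theta> (mset_set (E_set (a # v) g)) = mset_set A
        \<longleftrightarrow> g 0 \<in> A \<and> {#?g 0#} + image_mset ?g (mset_set (step_set v ?g))
           + image_mset ?t (mset_set (E_set v ?g)) = mset_set (A - {g 0})"
    proof -
      have "image_mset g (mset_set (step_set (a # v) g)) = {#g 1#} + image_mset ?g (mset_set (step_set v ?g))"
        unfolding sets(2) by (rule mset_set_insert_1_image_Suc) simp_all
      moreover have "image_mset \<theta> (mset_set (E_set (a # v) g)) = image_mset ?t (mset_set (E_set v ?g))"
        unfolding imt sets(1) if_False Un_empty_left by (rule mset_set_insert_1_image_Suc) simp_all
      ultimately show ?thesis
        using single_plus_eq_mset_set_iff[OF assms, of "g 0"]
        by (simp add: add_mset_commute[of "g (Suc 0)" "g 0"])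
    qed
    show ?thesis
      unfolding paths_in_def mem_Collect_eq prod.case extg cov dec ms
        ext
      using True ne by auto
  next
    case not_step: False
    then have step: "step_set (a # v) g = Suc ` step_set v ?g"
      by (simp only: step_set_Cons if_False Un_empty_left)
    show ?thesis
    proof (cases "g 1 = g 0")
      case True
      then have E: "E_set (a # v) g = {1} \<union> Suc ` E_set v ?g"
        "E_set (a # v) g = (if True then {1} else {}) \<union> Suc ` E_set v ?g"
        by (simp_all add: E_set_Cons)
      have ext: "\<theta> \<in> extensional (E_set (a # v) g)
          \<longleftrightarrow> \<theta> 0 = undefined \<and> ?t \<in> extensional (E_set v ?g)"
        unfolding E(2) using extensional_insert_1_image_Suc[of "E_set v ?g" \<theta> True] by simp
      have cov: "E_set (a # v) g \<union> step_set (a # v) g = {1..length (a # v)}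
          \<longleftrightarrow> E_set v ?g \<union> step_set v ?g = {1..length v}"
        using cover[of "{1}" "E_set v ?g \<union> step_set v ?g"] unfolding E(1) step by (auto simp: Un_ac)
      have dec: "(\<forall>i\<in>E_set (a # v) g. advances (letter (a # v) i) (\<theta> i) (g (i - 1)))
          \<longleftrightarrow> advances a (\<theta> 1) (g 0) \<and> (\<forall>i\<in>E_set v ?g. advances (letter v i) (?t i) (?g (i - 1)))"
        unfolding E(1) using deco by simp
      have ms: "{#g 0#} + image_mset g (mset_set (step_set (a # v) g))
             + image_mset \<theta> (mset_set (E_set (a # v) g)) = mset_set A
          \<longleftrightarrow> \<theta> 1 \<in> A \<and> {#?g 0#} + image_mset ?g (mset_set (step_set v ?g))
             + image_mset ?t (mset_set (E_set v ?g)) = mset_set (A - {\<theta> 1})"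
      proof -
        have "image_mset g (mset_set (step_set (a # v) g)) = image_mset ?g (mset_set (step_set v ?g))"
          unfolding step by (rule mset_set_insert_1_image_Suc) simp_all
        moreover have "image_mset \<theta> (mset_set (E_set (a # v) g))
            = {#\<theta> 1#} + image_mset ?t (mset_set (E_set v ?g))"
          unfolding imt E(1) by (rule mset_set_insert_1_image_Suc) simp_all
        ultimately show ?thesis
          using single_plus_eq_mset_set_iff[OF assms, of "\<theta> 1"] True
          by (simp add: add_mset_commute[of "g 0" "\<theta> (Suc 0)"])
      qed
      show ?thesis
        unfolding paths_in_def mem_Collect_eq prod.case extg cov dec ms
          ext
        using True not_step by auto
    next
      case False
      then have E: "E_set (a # v) g = Suc ` E_set v ?g"
        by (simp only: E_set_Cons if_False Un_empty_left)
      have "E_set (a # v) g \<union> step_set (a # v) g \<noteq> {1..length (a # v)}"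
        using cover[of "{}" "E_set v ?g \<union> step_set v ?g"] unfolding E step by (auto simp: Un_ac)
      then show ?thesis
        using False not_step by (auto simp: paths_in_def)
    qed
  qed
qed

lemma paths_in_Nil: "paths_in [] A k = (if mset_set A = {#k#} then {((\<lambda>_. undefined)(0 := k), \<lambda>_. undefined)} else {})"
  by (auto simp: paths_in_def E_set_def step_set_def extensional_def fun_eq_iff)

definition path_weight :: "'a::comm_semiring_1 \<Rightarrow> 'a \<Rightarrow> sign list \<Rightarrow> (nat \<Rightarrow> nat) \<Rightarrow> 'a" where
  "path_weight p q w g = p ^ card (S_plus w g) * q ^ card (S_minus w g)"

lemma path_weight_Nil [simp]: "path_weight p q [] g = 1"
  by (simp add: path_weight_def S_plus_def S_minus_def)

lemma path_weight_eq_prod: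
  "path_weight p q w g = (\<Prod>i\<in>step_set w g. sign_weight p q (letter w i))"
proof -
  have disj: "S_plus w g \<inter> S_minus w g = {}" and fin: "finite (S_plus w g)" "finite (S_minus w g)"
    by (auto simp: S_plus_def S_minus_def)
  have "(\<Prod>i\<in>S_plus w g. sign_weight p q (letter w i)) = p ^ card (S_plus w g)"
    "(\<Prod>i\<in>S_minus w g. sign_weight p q (letter w i)) = q ^ card (S_minus w g)"
    by (simp_all add: S_plus_def S_minus_def)
  then show ?thesis
    unfolding step_set_eq path_weight_def by (simp add: prod.union_disjoint disj fin)
qed

lemma path_weight_Cons:
  "path_weight p q (a # v) g =
    (if advances a (g 0) (g 1) then sign_weight p q a else 1) * path_weight p q v (g \<circ> Suc)"
proof -
  have "1 \<notin> Suc ` step_set v (g \<circ> Suc)"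
    by (metis imageE nat.inject One_nat_def zero_notin_E_set_step_set(2))
  moreover have "(\<Prod>i\<in>Suc ` step_set v (g \<circ> Suc). sign_weight p q (letter (a # v) i))
      = path_weight p q v (g \<circ> Suc)"
    unfolding path_weight_eq_prod
    by (subst prod.reindex) (auto intro!: prod.cong simp: step_set_def nth_Cons')
  ultimately show ?thesis
    unfolding path_weight_eq_prod[of p q "a # v"] step_set_Cons by simp
qed

text \<open>
  The inverse of taking the tail: \<open>k\<close> is the new starting point and \<open>d\<close> the decoration of the new
  first index, \<open>undefined\<close> if the path moves there.
\<close>

definition prepend_step :: "nat \<Rightarrow> nat \<Rightarrow> (nat \<Rightarrow> nat) \<times> (nat \<Rightarrow> nat) \<Rightarrow> (nat \<Rightarrow> nat) \<times> (nat \<Rightarrow> nat)" where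
  "prepend_step k d = (\<lambda>(h, \<eta>). (case_nat k h, case_nat undefined (\<eta>(0 := d))))"

lemma prepend_step_tail_path:
  assumes "g 0 = k" "\<theta> 0 = undefined" "\<theta> 1 = d"
  shows "prepend_step k d (tail_path (g, \<theta>)) = (g, \<theta>)"
  using assms by (auto simp: prepend_step_def fun_eq_iff split: nat.splits)

lemma paths_in_at_0:
  assumes "(h, \<eta>) \<in> paths_in v A k"
  shows "h 0 = k" "\<eta> 0 = undefined"
  using assms extensional_arb[of \<eta> "E_set v h" 0] by (auto simp: paths_in_def)

lemma tail_path_prepend_step:
  assumes "\<eta> 0 = undefined"
  shows "tail_path (prepend_step k d (h, \<eta>)) = (h, \<eta>)"
  using assms by (auto simp: prepend_step_def fun_eq_iff)

lemma inj_on_prepend_step: "inj_on (prepend_step k d) (paths_in v A l)"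
  by (rule inj_on_inverseI[of _ tail_path]) (auto simp del: split_paired_All simp: paths_in_at_0 tail_path_prepend_step)

lemma paths_in_Cons:
  assumes "finite A" "k \<in> A"
  shows "paths_in (a # v) A k =
      (\<Union>l\<in>{l\<in>A. advances a k l}. prepend_step k undefined ` paths_in v (A - {k}) l)
    \<union> (\<Union>j\<in>{j\<in>A. advances a j k}. prepend_step k j ` paths_in v (A - {j}) k)" (is "_ = ?L \<union> ?J")
proof (intro equalityI subsetI)
  fix x assume x: "x \<in> paths_in (a # v) A k"
  obtain g \<theta> where [simp]: "x = (g, \<theta>)" by force
  have g1: "g 1 \<in> A" if "tail_path (g, \<theta>) \<in> paths_in v (A - {k}) (g 1)"
  proof -
    have "set_mset ({#g 1#} + M + N) = A - {k} \<Longrightarrow> g 1 \<in> A" for M N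
      by auto
    then show ?thesis
      using that assms(1) by (auto simp: paths_in_def dest!: arg_cong[of _ _ set_mset])
  qed
  show "x \<in> ?L \<union> ?J"
    using x g1 prepend_step_tail_path[of g k \<theta> "\<theta> 1"]
    unfolding \<open>x = _\<close> paths_in_Cons_iff[OF assms(1)]
    by (auto simp del: One_nat_def split_paired_All) (metis (mono_tags, lifting) CollectI image_eqI)+
next
  fix x assume "x \<in> ?L \<union> ?J"
  then show "x \<in> paths_in (a # v) A k"
  proof
    assume "x \<in> ?L"
    then obtain l h \<eta> where *: "l \<in> A" "advances a k l" "(h, \<eta>) \<in> paths_in v (A - {k}) l"
      "x = prepend_step k undefined (h, \<eta>)" by auto
    then show ?thesis
      using paths_in_at_0[OF *(3)] assms tail_path_prepend_step[of \<eta> k undefined h]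
      by (auto simp: prepend_step_def paths_in_Cons_iff)
  next
    assume "x \<in> ?J"
    then obtain j h \<eta> where *: "j \<in> A" "advances a j k" "(h, \<eta>) \<in> paths_in v (A - {j}) k"
      "x = prepend_step k j (h, \<eta>)" by auto
    then show ?thesis
      using paths_in_at_0[OF *(3)] assms tail_path_prepend_step[of \<eta> k j h]
      by (auto simp: prepend_step_def paths_in_Cons_iff)
  qed
qed

text \<open>
  The paths split by their next endpoint, if they move, or by their first decoration, if they
  stay. These are the two sums in the recursion for \<^const>\<open>deletion_sum\<close>. Finiteness is carried
  along because the sum is split over a union.
\<close>

lemma sum_path_weight:
  assumes "finite A" "k \<in> A" "card A = length w + 1"
  shows "finite (paths_in w A k) \<and>
    (\<Sum>(g, \<theta>)\<in>paths_in w A k. path_weight p q w g) = deletion_sum p q w A k"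
  using assms
proof (induction w arbitrary: A k)
  case Nil
  then have "A = {k}"
    by (auto simp: card_1_singleton_iff)
  then show ?case
    by (simp add: paths_in_Nil)
next
  case (Cons a v)
  have card: "card (A - {j}) = length v + 1" "finite (A - {j})" if "j \<in> A" for j
    using that Cons.prems by simp_all
  define L where "L = {l\<in>A. advances a k l}"
  define J where "J = {j\<in>A. advances a j k}"
  have fin: "finite L" "finite J"
    using Cons.prems(1) by (auto simp: L_def J_def)
  let ?w = "\<lambda>u (g, \<theta>::nat \<Rightarrow> nat). path_weight p q u g"
  define X where "X l = prepend_step k undefined ` paths_in v (A - {k}) l" for l
  define Y where "Y j = prepend_step k j ` paths_in v (A - {j}) k" for j
  have L: "finite (paths_in v (A - {k}) l)"
    "sum (?w v) (paths_in v (A - {k}) l) = deletion_sum p q v (A - {k}) l" if "l \<in> L" for l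
  proof -
    have "l \<in> A - {k}" using that by (auto simp: L_def)
    then show "finite (paths_in v (A - {k}) l)"
      "sum (?w v) (paths_in v (A - {k}) l) = deletion_sum p q v (A - {k}) l"
      using Cons.IH[of "A - {k}" l] card[of k] Cons.prems(2) by simp_all
  qed
  have J: "finite (paths_in v (A - {j}) k)"
    "sum (?w v) (paths_in v (A - {j}) k) = deletion_sum p q v (A - {j}) k" if "j \<in> J" for j
  proof -
    have "k \<in> A - {j}" "j \<in> A" using that Cons.prems(2) by (auto simp: J_def)
    then show "finite (paths_in v (A - {j}) k)"
      "sum (?w v) (paths_in v (A - {j}) k) = deletion_sum p q v (A - {j}) k"
      using Cons.IH[of "A - {j}" k] card[of j] by simp_all
  qed
  have X1: "fst x 1 = l" if "x \<in> X l" for x l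
    using that by (auto simp: X_def Y_def prepend_step_def paths_in_at_0)
  have Y1: "fst x 1 = k" "snd x 1 = j" if "x \<in> Y j" for x j
    using that by (auto simp: X_def Y_def prepend_step_def paths_in_at_0)
  have sumX: "sum (?w (a # v)) (X l) = sign_weight p q a * deletion_sum p q v (A - {k}) l"
    if "l \<in> L" for l
  proof -
    have "sum (?w (a # v)) (X l) = (\<Sum>x\<in>paths_in v (A - {k}) l. sign_weight p q a * ?w v x)"
      unfolding X_def Y_def sum.reindex[OF inj_on_prepend_step] using that
      by (intro sum.cong refl)
         (auto simp: prepend_step_def path_weight_Cons paths_in_at_0 L_def comp_def)
    then show ?thesis
      using L[OF that] by (simp add: sum_distrib_left[symmetric])
  qed
  have sumY: "sum (?w (a # v)) (Y j) = deletion_sum p q v (A - {j}) k"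
    if "j \<in> J" for j
  proof -
    have "sum (?w (a # v)) (Y j) = (\<Sum>x\<in>paths_in v (A - {j}) k. ?w v x)"
      unfolding X_def Y_def sum.reindex[OF inj_on_prepend_step] using that
      by (intro sum.cong refl)
         (auto simp: prepend_step_def path_weight_Cons paths_in_at_0 comp_def)
    then show ?thesis
      using J[OF that] by simp
  qed
  have eq: "paths_in (a # v) A k = (\<Union>l\<in>L. X l) \<union> (\<Union>j\<in>J. Y j)"
    unfolding paths_in_Cons[OF Cons.prems(1,2)] L_def J_def X_def Y_def ..
  have finXY: "finite (\<Union>l\<in>L. X l)" "finite (\<Union>j\<in>J. Y j)"
    using fin L(1) J(1) by (simp_all add: X_def Y_def)
  have "X l \<inter> Y j = {}" if "l \<in> L" for l j
  proof -
    have "l \<noteq> k" using that by (auto simp: L_def)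
    then show ?thesis using X1 Y1(1) by (metis disjoint_iff)
  qed
  then have "(\<Union>l\<in>L. X l) \<inter> (\<Union>j\<in>J. Y j) = {}"
    by blast
  then have "sum (?w (a # v)) (paths_in (a # v) A k)
      = sum (?w (a # v)) (\<Union>l\<in>L. X l) + sum (?w (a # v)) (\<Union>j\<in>J. Y j)"
    unfolding eq by (rule sum.union_disjoint[OF finXY])
  also have "sum (?w (a # v)) (\<Union>l\<in>L. X l) = (\<Sum>l\<in>L. sum (?w (a # v)) (X l))"
  proof (rule sum.UNION_disjoint)
    show "\<forall>l\<in>L. finite (X l)" using L(1) by (simp add: X_def)
    show "\<forall>l\<in>L. \<forall>l'\<in>L. l \<noteq> l' \<longrightarrow> X l \<inter> X l' = {}" using X1 by (metis disjoint_iff)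
  qed (rule fin)
  also have "sum (?w (a # v)) (\<Union>j\<in>J. Y j) = (\<Sum>j\<in>J. sum (?w (a # v)) (Y j))"
  proof (rule sum.UNION_disjoint)
    show "\<forall>j\<in>J. finite (Y j)" using J(1) by (simp add: Y_def)
    show "\<forall>j\<in>J. \<forall>j'\<in>J. j \<noteq> j' \<longrightarrow> Y j \<inter> Y j' = {}" using Y1(2) by (metis disjoint_iff)
  qed (rule fin)
  finally have "sum (?w (a # v)) (paths_in (a # v) A k) = deletion_sum p q (a # v) A k"
    by (simp add: sumX sumY sum_distrib_left L_def J_def)
  then show ?case
    using finXY unfolding eq by simp
qed

lemma R_eq_deletion_sum:
  assumes "k \<in> {1..length w + 1}"
  shows "R p q w k = deletion_sum p q w {1..length w + 1} k"
  using sum_path_weight[of "{1..length w + 1}" k w p q] assms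
  unfolding R_def decorated_paths_eq_paths_in path_weight_def by simp


section \<open>Greedy records\<close>

text \<open>
  The greedy scan read from right to left: \<open>x\<close> is the current record, \<open>ys\<close> lists the entries still to
  its left, nearest first, and \<open>w\<close> their letters.
\<close>

fun record_weight :: "'a::comm_semiring_1 \<Rightarrow> 'a \<Rightarrow> sign list \<Rightarrow> 'b::linorder \<Rightarrow> 'b list \<Rightarrow> 'a" where
  "record_weight p q (a # w) x (y # ys) =
     (if advances a x y then sign_weight p q a * record_weight p q w y ys
      else record_weight p q w x ys)"
| "record_weight p q w x ys = 1"

lemma sum_permutations_of_set_nonempty:
  assumes "finite A" "A \<noteq> {}"
  shows "(\<Sum>xs\<in>permutations_of_set A. f xs) =
    (\<Sum>x\<in>A. \<Sum>xs\<in>permutations_of_set (A - {x}). f (x # xs))"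
proof -
  have "(\<Sum>xs\<in>permutations_of_set A. f xs) =
      (\<Sum>x\<in>A. \<Sum>xs\<in>(#) x ` permutations_of_set (A - {x}). f xs)"
    unfolding permutations_of_set_nonempty[OF assms(2)]
    using assms(1) by (subst sum.UNION_disjoint) auto
  then show ?thesis
    by (simp add: sum.reindex)
qed

text \<open>
  If the entry \<open>y\<close> next to \<open>k\<close> is a record, the scan continues from \<open>y\<close> and \<open>k\<close> has left the set. If
  not, \<open>k\<close> stays the current record and \<open>y\<close> is discarded. Hence this sum satisfies the recursion
  for \<^const>\<open>deletion_sum\<close>.
\<close>

lemma sum_record_weight:
  assumes "finite A" "k \<in> A" "card A = length w + 1"
  shows "(\<Sum>ys\<in>permutations_of_set (A - {k}). record_weight p q w k ys) = deletion_sum p q w A k"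
  using assms
proof (induction w arbitrary: A k)
  case Nil
  then have "A = {k}"
    by (auto simp: card_1_singleton_iff)
  then show ?case by simp
next
  case (Cons a v)
  have "card (A - {k}) = length v + 1"
    using Cons.prems by simp
  then have ne: "A - {k} \<noteq> {}"
    by (metis Suc_eq_plus1 card.empty nat.distinct(1))
  let ?S = "\<lambda>B. permutations_of_set B"
  have IH: "(\<Sum>ys\<in>?S (A - {j} - {l}). record_weight p q v l ys) = deletion_sum p q v (A - {j}) l"
    if "j \<in> A" "l \<in> A" "j \<noteq> l" for j l
    using Cons.IH[of "A - {j}" l] Cons.prems that by simp
  have cases: "advances a y k" if "y \<noteq> k" "\<not> advances a k y" for y
    using that by (cases a) auto
  have asym: "\<not> advances a y k" if "advances a k y" for y
    using that by (cases a) auto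
  have "(\<Sum>ys\<in>?S (A - {k}). record_weight p q (a # v) k ys)
      = (\<Sum>y\<in>A - {k}. \<Sum>ys\<in>?S (A - {k} - {y}). record_weight p q (a # v) k (y # ys))"
    using Cons.prems(1) ne by (intro sum_permutations_of_set_nonempty) auto
  also have "\<dots> = (\<Sum>y\<in>A - {k}. if advances a k y
      then sign_weight p q a * deletion_sum p q v (A - {k}) y else deletion_sum p q v (A - {y}) k)"
  proof (intro sum.cong refl)
    fix y assume y: "y \<in> A - {k}"
    \<comment> \<open>The order of the two deletions is exchanged so that \<open>y\<close> is the one deleted by the recursion.\<close>
    have comm: "A - {k} - {y} = A - {y} - {k}" by blast
    show "(\<Sum>ys\<in>?S (A - {k} - {y}). record_weight p q (a # v) k (y # ys)) =
       (if advances a k y then sign_weight p q a * deletion_sum p q v (A - {k}) y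
        else deletion_sum p q v (A - {y}) k)"
    proof (cases "advances a k y")
      case True
      then show ?thesis
        using IH[of k y] y Cons.prems(2) by (auto simp: sum_distrib_left[symmetric])
    next
      case False
      then show ?thesis
        unfolding comm using IH[of y k] y Cons.prems(2) by simp
    qed
  qed
  also have "\<dots> = (\<Sum>y\<in>{l\<in>A. advances a k l}. sign_weight p q a * deletion_sum p q v (A - {k}) y)
      + (\<Sum>y\<in>{j\<in>A. advances a j k}. deletion_sum p q v (A - {y}) k)"
  proof -
    have fin: "finite (A - {k})"
      using Cons.prems(1) by simp
    have sets: "(A - {k}) \<inter> {y. advances a k y} = {l\<in>A. advances a k l}"
      "(A - {k}) \<inter> - {y. advances a k y} = {j\<in>A. advances a j k}"
      by (use cases asym in blast) (use cases asym advances_irrefl[of a k] in blast)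
    show ?thesis
      unfolding sum.If_cases[OF fin] sets ..
  qed
  also have "\<dots> = deletion_sum p q (a # v) A k"
    by (simp add: sum_distrib_left)
  finally show ?case .
qed

text \<open>
  A scan that has passed all positions above \<open>m\<close> without finding a candidate for \<open>i\<close>. If \<open>m\<close> is a
  candidate it is the largest one, hence the next element of the greedy sequence.
\<close>

lemma prod_list_greedy_seq_eq_record_weight:
  "(\<Prod>l\<leftarrow>tl (greedy_seq \<epsilon> \<pi> i). sign_weight p q (letter \<epsilon> l))
   = record_weight p q (map (letter \<epsilon>) (rev [1..<Suc m])) (\<pi> i) (map \<pi> (rev [1..<Suc m]))"
  if "m < i" "\<And>l. l \<in> greedy_candidates \<epsilon> \<pi> i \<Longrightarrow> l \<le> m"
  using that
proof (induction m arbitrary: i)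
  case 0
  then have "greedy_candidates \<epsilon> \<pi> i = {}"
    by (fastforce simp: greedy_candidates_def)
  then show ?case
    by (simp add: greedy_seq.simps)
next
  case (Suc m)
  let ?C = "greedy_candidates \<epsilon> \<pi> i"
  have up: "rev [1..<Suc (Suc m)] = Suc m # rev [1..<Suc m]"
    by simp
  have mem: "Suc m \<in> ?C \<longleftrightarrow> advances (letter \<epsilon> (Suc m)) (\<pi> i) (\<pi> (Suc m))"
    using Suc.prems(1) by (cases "letter \<epsilon> (Suc m)") (auto simp: greedy_candidates_def)
  show ?case
  proof (cases "Suc m \<in> ?C")
    case True
    have "finite ?C" by (simp add: greedy_candidates_def)
    then have Max: "Max ?C = Suc m"
      using True Suc.prems(2) by (intro Max_eqI) auto
    have seq: "tl (greedy_seq \<epsilon> \<pi> i) = greedy_seq \<epsilon> \<pi> (Suc m)"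
      using True Max by (subst greedy_seq.simps) auto
    have hd: "greedy_seq \<epsilon> \<pi> (Suc m) = Suc m # tl (greedy_seq \<epsilon> \<pi> (Suc m))"
      by (subst (1 2) greedy_seq.simps) simp
    have "l \<le> m" if "l \<in> greedy_candidates \<epsilon> \<pi> (Suc m)" for l
      using that by (auto simp: greedy_candidates_def)
    then have "(\<Prod>l\<leftarrow>tl (greedy_seq \<epsilon> \<pi> (Suc m)). sign_weight p q (letter \<epsilon> l))
      = record_weight p q (map (letter \<epsilon>) (rev [1..<Suc m])) (\<pi> (Suc m)) (map \<pi> (rev [1..<Suc m]))"
      by (intro Suc.IH) auto
    then show ?thesis
      unfolding seq up using True mem by (subst hd) (simp del: upt_Suc)
  next
    case False
    then have "l \<le> m" if "l \<in> ?C" for l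
      using that Suc.prems(2)[OF that] by (metis le_SucE)
    then have "(\<Prod>l\<leftarrow>tl (greedy_seq \<epsilon> \<pi> i). sign_weight p q (letter \<epsilon> l))
      = record_weight p q (map (letter \<epsilon>) (rev [1..<Suc m])) (\<pi> i) (map \<pi> (rev [1..<Suc m]))"
      using Suc.prems(1) by (intro Suc.IH) auto
    then show ?thesis
      unfolding up using False mem by (simp del: upt_Suc)
  qed
qed

lemma prod_list_sign_weight:
  fixes p q :: "'a::comm_semiring_1"
  shows "(\<Prod>l\<leftarrow>xs. sign_weight p q (f l)) =
   p ^ length (filter (\<lambda>l. f l = Plus) xs) * q ^ length (filter (\<lambda>l. f l = Minus) xs)"
proof (induction xs)
  case (Cons x xs)
  then show ?case by (cases "f x") (simp_all add: ac_simps)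
qed simp

lemma greedy_records_eq_length_filter:
  "greedy_records s \<epsilon> \<pi> =
   length (filter (\<lambda>l. letter \<epsilon> l = s) (tl (greedy_seq \<epsilon> \<pi> (length \<epsilon> + 1))))"
proof -
  let ?is = "greedy_seq \<epsilon> \<pi> (length \<epsilon> + 1)"
  have "{j. 1 \<le> j \<and> j < length ?is \<and> letter \<epsilon> (?is ! j) = s}
      = Suc ` {j. j < length (tl ?is) \<and> letter \<epsilon> (tl ?is ! j) = s}" (is "?A = Suc ` ?B")
  proof (intro equalityI subsetI)
    fix j assume "j \<in> ?A"
    then show "j \<in> Suc ` ?B"
      by (intro image_eqI[of _ _ "j - 1"]) (auto simp: nth_tl)
  qed (auto simp: nth_tl)
  then show ?thesis
    by (simp add: greedy_records_def Let_def length_filter_conv_card card_image)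
qed

lemma greedy_weight_eq_record_weight:
  "p ^ greedy_records Plus \<epsilon> \<pi> * q ^ greedy_records Minus \<epsilon> \<pi>
   = record_weight p q (rev \<epsilon>) (\<pi> (length \<epsilon> + 1)) (map \<pi> (rev [1..<length \<epsilon> + 1]))"
proof -
  have "map (letter \<epsilon>) (rev [1..<Suc (length \<epsilon>)]) = rev \<epsilon>"
    unfolding rev_map[symmetric] 
    by (rule arg_cong[of _ _ rev]) (auto intro!: nth_equalityI simp del: upt_Suc)
  moreover have "l \<le> length \<epsilon>" if "l \<in> greedy_candidates \<epsilon> \<pi> (length \<epsilon> + 1)" for l
    using that by (auto simp: greedy_candidates_def)
  ultimately show ?thesis
    using prod_list_greedy_seq_eq_record_weight[of "length \<epsilon>" "length \<epsilon> + 1" \<epsilon> \<pi> p q]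
    unfolding prod_list_sign_weight greedy_records_eq_length_filter by simp
qed

text \<open>
  Distinct permutations give distinct arrangements, and both sides have \<open>n!\<close> elements.
\<close>

lemma bij_betw_map_permutes:
  assumes "distinct xs"
  shows "bij_betw (\<lambda>\<pi>. map \<pi> xs) {\<pi>. \<pi> permutes set xs} (permutations_of_set (set xs))"
proof -
  have inj: "inj_on (\<lambda>\<pi>. map \<pi> xs) {\<pi>. \<pi> permutes set xs}"
    by (intro inj_onI) (metis (no_types, lifting) ext map_eq_conv mem_Collect_eq permutes_not_in)
  have sub: "(\<lambda>\<pi>. map \<pi> xs) ` {\<pi>. \<pi> permutes set xs} \<subseteq> permutations_of_set (set xs)"
    using assms by (auto simp: permutations_of_set_def distinct_map permutes_inj_on permutes_image)
  have "card ((\<lambda>\<pi>. map \<pi> xs) ` {\<pi>. \<pi> permutes set xs}) = card (permutations_of_set (set xs))"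
    using card_image[OF inj] by (simp add: card_permutations)
  then have "(\<lambda>\<pi>. map \<pi> xs) ` {\<pi>. \<pi> permutes set xs} = permutations_of_set (set xs)"
    using sub by (intro card_subset_eq) simp_all
  then show ?thesis
    using inj by (simp add: bij_betw_def)
qed

lemma sum_greedy_records:
  fixes p q :: "'a::comm_semiring_1" and \<epsilon> :: "sign list"
  defines "n \<equiv> length \<epsilon> + 1"
  shows "(\<Sum>\<pi> | \<pi> permutes {1..n}. p ^ greedy_records Plus \<epsilon> \<pi> * q ^ greedy_records Minus \<epsilon> \<pi>)
    = (\<Sum>k=1..n. deletion_sum p q (rev \<epsilon>) {1..n} k)"
proof -
  define xs where "xs = rev [1..<Suc n]"
  have ne: "{1..n} \<noteq> {}"
    by (simp add: n_def)
  have set: "set xs = {1..n}" and dist: "distinct xs"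
    by (auto simp: xs_def)
  have xs: "xs = n # rev [1..<n]"
    by (simp add: xs_def n_def)
  have "(\<Sum>\<pi> | \<pi> permutes {1..n}. p ^ greedy_records Plus \<epsilon> \<pi> * q ^ greedy_records Minus \<epsilon> \<pi>)
      = (\<Sum>\<pi> | \<pi> permutes set xs. (\<lambda>ys. record_weight p q (rev \<epsilon>) (hd ys) (tl ys)) (map \<pi> xs))"
    unfolding greedy_weight_eq_record_weight set by (simp add: xs n_def)
  also have "\<dots> = (\<Sum>ys\<in>permutations_of_set {1..n}. record_weight p q (rev \<epsilon>) (hd ys) (tl ys))"
    using sum.reindex_bij_betw[OF bij_betw_map_permutes[OF dist],
        of "\<lambda>ys. record_weight p q (rev \<epsilon>) (hd ys) (tl ys)"] unfolding set .
  also have "\<dots> = (\<Sum>k=1..n. \<Sum>ys\<in>permutations_of_set ({1..n} - {k}). record_weight p q (rev \<epsilon>) k ys)"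
    using sum_permutations_of_set_nonempty[OF finite_atLeastAtMost ne,
        of "\<lambda>ys. record_weight p q (rev \<epsilon>) (hd ys) (tl ys)"] by simp
  also have "\<dots> = (\<Sum>k=1..n. deletion_sum p q (rev \<epsilon>) {1..n} k)"
  proof (rule sum.cong[OF refl])
    fix k assume "k \<in> {1..n}"
    then show "(\<Sum>ys\<in>permutations_of_set ({1..n} - {k}). record_weight p q (rev \<epsilon>) k ys)
        = deletion_sum p q (rev \<epsilon>) {1..n} k"
      by (rule sum_record_weight[rotated]) (simp_all add: n_def)
  qed
  finally show ?thesis .
qed


section \<open>Bernstein expansion\<close>

lemma coeff_antideriv_0 [simp]: "coeff (antideriv f) 0 = 0"
  by (simp add: antideriv_def coeff_sum)

lemma coeff_antideriv_Suc [simp]: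
  "coeff (antideriv f) (Suc n) = smult [:1 / of_nat (Suc n):] (coeff f n)"
proof -
  have "coeff (antideriv f) (Suc n) =
      (\<Sum>i\<le>degree f. if i = n then smult [:1 / of_nat (Suc n):] (coeff f n) else 0)"
    unfolding antideriv_def coeff_sum by (intro sum.cong) auto
  also have "\<dots> = smult [:1 / of_nat (Suc n):] (coeff f n)"
    by (auto simp: coeff_eq_0)
  finally show ?thesis .
qed

lemma antideriv_add: "antideriv (f + g) = antideriv f + antideriv g"
proof (rule poly_eqI)
  fix n show "coeff (antideriv (f + g)) n = coeff (antideriv f + antideriv g) n"
    by (cases n) (simp_all add: smult_add_right)
qed

lemma antideriv_smult: "antideriv (smult c f) = smult c (antideriv f)"
proof (rule poly_eqI)
  fix n show "coeff (antideriv (smult c f)) n = coeff (smult c (antideriv f)) n"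
    by (cases n) (simp_all add: mult.commute)
qed

lemma antideriv_0: "antideriv 0 = 0"
  by (simp add: antideriv_def)

lemma antideriv_sum: "antideriv (\<Sum>i\<in>I. f i) = (\<Sum>i\<in>I. antideriv (f i))"
  by (induction I rule: infinite_finite_induct) (simp_all add: antideriv_add antideriv_0)

lemma pderiv_antideriv [simp]: "pderiv (antideriv f) = f"
proof (rule poly_eqI)
  fix n
  have "of_nat (Suc n) * smult [:1 / of_nat (Suc n):] (coeff f n) = coeff f n"
  proof -
    have "of_nat (Suc n) * smult [:1 / of_nat (Suc n):] (coeff f n)
        = smult (of_nat (Suc n) * [:1 / of_nat (Suc n):]) (coeff f n)"
      unfolding of_nat_poly[symmetric] by (simp only: of_nat_poly smult_smult mult_smult_left) (simp add: of_nat_poly)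
    also have "of_nat (Suc n) * [:1 / of_nat (Suc n):] = (1 :: rat poly)"
      by (simp add: of_nat_poly del: of_nat_Suc)
    finally show ?thesis by simp
  qed
  then show "coeff (pderiv (antideriv f)) n = coeff f n"
    by (simp add: coeff_pderiv del: of_nat_Suc)
qed

text \<open>
  An antiderivative is determined by its derivative and its value at 0, because the coefficients
  have characteristic 0.
\<close>

lemma antiderivI:
  assumes "pderiv F = smult c f" "poly F 0 = 0"
  shows "F = smult c (antideriv f)"
proof -
  have "pderiv (F - smult c (antideriv f)) = 0"
    using assms by (simp add: pderiv_diff pderiv_smult)
  then obtain d where d: "F - smult c (antideriv f) = [:d:]"
    by (metis pderiv_iszero)
  have "poly (F - smult c (antideriv f)) 0 = 0"
    using assms(2) by (simp add: poly_0_coeff_0)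
  then show ?thesis
    using d by simp
qed

lemma integral_poly_0_x: "integral_poly 0 ind_x f = antideriv f"
  by (simp add: integral_poly_def ind_x_def pcompose_idR pcompose_0' poly_0_coeff_0)

lemma integral_poly_x_1: "integral_poly ind_x 1 f = [:integral_const 0 1 f:] - antideriv f"
proof -
  have "pcompose g 1 = [:poly g 1:]" for g :: "rat poly poly poly"
    by (induction g) (simp_all add: pcompose_pCons)
  then show ?thesis
    by (simp add: integral_poly_def ind_x_def pcompose_idR integral_const_def poly_0_coeff_0)
qed

lemma integral_const_0_1: "integral_const 0 1 f = poly (antideriv f) 1"
  by (simp add: integral_const_def poly_0_coeff_0)

text \<open>
  The Bernstein polynomials with coefficients in \<open>\<rat>[p,q]\<close>, where antiderivatives are available.
\<close>

abbreviation (input) B :: "nat \<Rightarrow> nat \<Rightarrow> rat poly poly poly" where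
  "B \<equiv> bernstein"

lemma bernstein_Suc:
  "bernstein s (Suc i) = of_nat (s choose i) * ind_x ^ i * (1 - ind_x) ^ (s - i)"
  by (simp add: bernstein_def)

lemma ind_x_mult_bernstein:
  assumes "l \<in> {1..s + 1}"
  shows "of_nat (s + 1) * (ind_x * bernstein s l) = of_nat l * (bernstein (s + 1) (l + 1) :: 'a::comm_ring_1 poly)"
proof -
  obtain i where l: "l = Suc i" using assms by (cases l) auto
  let ?y = "ind_x ^ Suc i * (1 - ind_x) ^ (s - i) :: 'a poly"
  have "of_nat (Suc s * (s choose i)) * ?y = of_nat (Suc i * (Suc s choose Suc i)) * ?y"
    by (metis Suc_times_binomial_eq mult.commute)
  then show ?thesis
    by (simp only: l bernstein_Suc of_nat_mult power_Suc mult_ac diff_Suc_Suc Suc_eq_plus1[symmetric])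
qed

lemma one_minus_ind_x_mult_bernstein:
  assumes "l \<in> {1..s + 1}"
  shows "of_nat (s + 1) * ((1 - ind_x) * bernstein s l)
    = of_nat (s + 2 - l) * (bernstein (s + 1) l :: 'a::comm_ring_1 poly)"
proof -
  obtain i where l: "l = Suc i" "i \<le> s" using assms by (cases l) auto
  let ?y = "ind_x ^ i * (1 - ind_x) ^ Suc (s - i) :: 'a poly"
  have "Suc s * (s choose i) = (Suc s - i) * (Suc s choose i)"
    using l(2) by (metis binomial_absorb_comp diff_Suc_1)
  then have "of_nat (Suc s * (s choose i)) * ?y = of_nat ((Suc s - i) * (Suc s choose i)) * ?y"
    by (rule arg_cong)
  moreover have "Suc s - i = Suc (s - i)" "s + 2 - Suc i = Suc (s - i)"
    using l(2) by simp_all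
  ultimately show ?thesis
    by (simp only: l bernstein_Suc of_nat_mult power_Suc mult_ac Suc_eq_plus1[symmetric])
qed

lemma sum_bernstein: "(\<Sum>k=1..s + 1. bernstein s k) = (1 :: 'a::comm_ring_1 poly)"
proof -
  have "(\<Sum>k=1..s + 1. bernstein s k) = (\<Sum>i\<le>s. of_nat (s choose i) * ind_x ^ i * (1 - ind_x :: 'a poly) ^ (s - i))"
    by (rule sum.reindex_bij_witness[of _ Suc "\<lambda>k. k - 1"]) (auto simp: bernstein_def)
  also have "\<dots> = (ind_x + (1 - ind_x)) ^ s"
    by (simp only: binomial_ring)
  finally show ?thesis by simp
qed

lemma pderiv_bernstein:
  assumes "k \<in> {2..s + 2}"
  shows "pderiv (bernstein (s + 1) k) = of_nat (s + 1) * (bernstein s (k - 1) - (bernstein s k :: 'a::idom poly))"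
proof -
  define i where "i = k - 2"
  have k: "k = Suc (Suc i)" and i: "i \<le> s" using assms by (auto simp: i_def)
  let ?x = "ind_x :: 'a poly"
  have px: "pderiv ?x = 1" "pderiv (1 - ?x) = -1"
    by (simp_all add: ind_x_def pderiv_diff pderiv_pCons one_pCons)
  have "pderiv (bernstein (s + 1) k) = of_nat (Suc s choose Suc i) * pderiv (?x ^ Suc i * (1 - ?x) ^ (s - i))"
    by (simp add: bernstein_def k pderiv_mult mult.assoc del: of_nat_Suc binomial_Suc_Suc power_Suc)
  also have "pderiv (?x ^ Suc i * (1 - ?x) ^ (s - i)) =
     of_nat (Suc i) * ?x ^ i * (1 - ?x) ^ (s - i) - of_nat (s - i) * ?x ^ Suc i * (1 - ?x) ^ (s - Suc i)"
  proof (cases "s - i")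
    case 0
    then show ?thesis
      by (simp add: pderiv_power_Suc px of_nat_poly del: of_nat_Suc power_Suc)
  next
    case (Suc j)
    then have "s - Suc i = j" by simp
    with Suc show ?thesis
      by (simp add: pderiv_mult pderiv_power_Suc px of_nat_poly algebra_simps del: of_nat_Suc power_Suc)
  qed
  also have "of_nat (Suc s choose Suc i) * \<dots> =
      of_nat (Suc i * (Suc s choose Suc i)) * (?x ^ i * (1 - ?x) ^ (s - i))
      - of_nat ((Suc s - Suc i) * (Suc s choose Suc i)) * (?x ^ Suc i * (1 - ?x) ^ (s - Suc i))"
    by (simp only: of_nat_mult right_diff_distrib mult_ac diff_Suc_Suc)
  also have "Suc i * (Suc s choose Suc i) = Suc s * (s choose i)"
    by (metis Suc_times_binomial_eq mult.commute)
  also have "(Suc s - Suc i) * (Suc s choose Suc i) = Suc s * (s choose Suc i)"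
    using binomial_absorb_comp[of "Suc s" "Suc i"] by simp
  finally show ?thesis
    by (simp only: k bernstein_Suc of_nat_mult right_diff_distrib mult_ac diff_Suc_1 Suc_eq_plus1[symmetric])
qed

text \<open>
  The derivative of each \<open>B (s + 1) k\<close> is a difference of neighbouring Bernstein polynomials of
  degree \<open>s\<close>, so the derivative of the sum telescopes, and only the term at \<open>l\<close> survives.
\<close>

lemma antideriv_bernstein:
  assumes "l \<in> {1..s + 1}"
  shows "smult (of_nat (s + 1)) (antideriv (bernstein s l)) = (\<Sum>k=l + 1..s + 2. bernstein (s + 1) k)"
proof (rule antiderivI[symmetric])
  have "pderiv (\<Sum>k=l + 1..s + 2. B (s + 1) k) = (\<Sum>k=l + 1..s + 2. pderiv (B (s + 1) k))"
    by (rule higher_pderiv_sum[of 1, simplified])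
  also have "\<dots> = (\<Sum>k=l + 1..s + 2. of_nat (s + 1) * (B s (k - 1) - B s k))"
    using assms by (intro sum.cong refl pderiv_bernstein) auto
  also have "\<dots> = of_nat (s + 1) * (\<Sum>k=l + 1..s + 2. B s (k - 1) - B s k)"
    by (rule sum_distrib_left[symmetric])
  also have "(\<Sum>k=l + 1..s + 2. B s (k - 1) - B s k) = B s l - B s (s + 2)"
    using assms sum_telescope''[of l "s + 2" "\<lambda>k. - B s k"] by (simp add: Suc_eq_plus1[symmetric] del: sum.cl_ivl_Suc)
  also have "B s (s + 2) = 0"
    by (simp add: bernstein_def)
  finally show "pderiv (\<Sum>k=l + 1..s + 2. B (s + 1) k) = smult (of_nat (s + 1)) (B s l)"
    by (simp add: of_nat_poly)
next
  have "poly (B (s + 1) k) 0 = 0" if "k \<in> {l + 1..s + 2}" for k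
    using that assms by (simp add: bernstein_def ind_x_def)
  then show "poly (\<Sum>k=l + 1..s + 2. B (s + 1) k) 0 = 0"
    unfolding poly_sum by (intro sum.neutral ballI)
qed

text \<open>
  By the preceding lemma the antiderivative is a sum of Bernstein polynomials of the next degree
  that includes the last one, and only the last one does not vanish at 1.
\<close>

lemma integral_const_bernstein:
  assumes "l \<in> {1..s + 1}"
  shows "of_nat (s + 1) * integral_const 0 1 (bernstein s l) = 1"
proof -
  have "of_nat (s + 1) * integral_const 0 1 (B s l) = poly (\<Sum>k=l + 1..s + 2. B (s + 1) k) 1"
    unfolding antideriv_bernstein[OF assms, symmetric] integral_const_0_1 by simp
  also have "\<dots> = (\<Sum>k=l + 1..s + 2. if k = s + 2 then 1 else 0)"
    unfolding poly_sum using assms 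
    by (intro sum.cong refl) (auto simp: bernstein_def ind_x_def poly_of_nat)
  also have "\<dots> = 1"
    using assms by simp
  finally show ?thesis .
qed

lemma integral_poly_0_x_bernstein:
  assumes "l \<in> {1..s + 1}"
  shows "of_nat (s + 1) * integral_poly 0 ind_x (bernstein s l) = (\<Sum>k=l + 1..s + 2. bernstein (s + 1) k)"
  using antideriv_bernstein[OF assms] by (simp add: integral_poly_0_x of_nat_poly)

text \<open>
  The complement of the integral from 0, as the Bernstein polynomials of degree \<open>s + 1\<close> sum to 1.
\<close>

lemma integral_poly_x_1_bernstein:
  assumes "l \<in> {1..s + 1}"
  shows "of_nat (s + 1) * integral_poly ind_x 1 (bernstein s l) = (\<Sum>k=1..l. bernstein (s + 1) k)"
proof -
  have "{1..s + 1 + 1} = {1..l} \<union> {l + 1..s + 2}"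
    using assms by auto
  then have "(\<Sum>k=1..s + 1 + 1. B (s + 1) k) = (\<Sum>k=1..l. B (s + 1) k) + (\<Sum>k=l + 1..s + 2. B (s + 1) k)"
    using sum.union_disjoint[of "{1..l}" "{l + 1..s + 2}" "B (s + 1)"] by simp
  then have "(\<Sum>k=1..l. B (s + 1) k) = 1 - (\<Sum>k=l + 1..s + 2. B (s + 1) k)"
    unfolding sum_bernstein by simp
  moreover have "of_nat (s + 1) * [:integral_const 0 1 (B s l):] = 1"
    using integral_const_bernstein[OF assms] by (simp add: of_nat_poly one_pCons del: of_nat_add of_nat_Suc)
  ultimately show ?thesis
    using antideriv_bernstein[OF assms] 
    by (simp add: integral_poly_x_1 of_nat_poly right_diff_distrib del: of_nat_add of_nat_Suc)
qed

lemma smult_sum_right: "smult c (\<Sum>i\<in>I. f i) = (\<Sum>i\<in>I. smult c (f i))"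
  by (induction I rule: infinite_finite_induct) (simp_all add: smult_add_right)

lemma integral_poly_sum_smult:
  "integral_poly a b (\<Sum>i\<in>I. smult (c i) (f i)) = (\<Sum>i\<in>I. smult (c i) (integral_poly a b (f i)))"
  by (simp add: integral_poly_def antideriv_sum antideriv_smult pcompose_sum pcompose_smult
      sum_subtractf smult_diff_right)

lemma integral_const_sum_smult:
  "integral_const a b (\<Sum>i\<in>I. smult (c i) (f i)) = (\<Sum>i\<in>I. c i * integral_const a b (f i))"
  by (simp add: integral_const_def antideriv_sum antideriv_smult poly_sum sum_subtractf right_diff_distrib)

lemma integral_poly_of_nat_mult: "integral_poly a b (of_nat m * f) = of_nat m * integral_poly a b f"
  by (simp add: integral_poly_def of_nat_poly antideriv_smult pcompose_smult smult_diff_right)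

lemma integral_const_of_nat_mult: "integral_const a b (of_nat m * f) = of_nat m * integral_const a b f"
  by (simp add: integral_const_def of_nat_poly antideriv_smult right_diff_distrib)

text \<open>
  Multiplication by \<open>x\<close> or \<open>1 - x\<close> moves a Bernstein polynomial to a single one of the next degree,
  with factor \<open>l\<close> or \<open>s + 2 - l\<close> over \<open>s + 1\<close>; the integrals give \<open>1 / (s + 1)\<close> times a sum
  over all \<open>k \<le> l\<close> or all \<open>k > l\<close>. The recursion for \<open>K\<close> thus becomes the standardised
  recursion for \<^const>\<open>deletion_sum\<close>, after exchanging the order of summation.
\<close>

theorem K_bernstein_expansion:
  "of_nat (fact (length w)) * K p q w
    = (\<Sum>k=1..length w + 1. smult (deletion_sum p q w {1..length w + 1} k) (bernstein (length w) k))"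
proof (induction w)
  case Nil
  show ?case by (simp add: bernstein_def)
next
  case (Cons a v)
  let ?s = "length v"
  define d where "d = deletion_sum p q v {1..?s + 1}"
  let ?K = "of_nat (fact ?s) * K p q v"
  have IH: "?K = (\<Sum>l=1..?s + 1. smult (d l) (B ?s l))"
    using Cons by (simp only: d_def)
  have fact: "of_nat (fact (Suc ?s)) = (of_nat (?s + 1) * of_nat (fact ?s) :: rat poly poly poly)"
    by (simp only: fact_Suc of_nat_mult of_nat_id Suc_eq_plus1[symmetric])
  have smult_of_nat: "of_nat m * smult c f = smult c (of_nat m * f)" for m c and f :: "rat poly poly poly"
    by (simp add: mult_smult_right)
  show ?case
  proof (cases a)
    case Plus
    have "of_nat (fact (Suc ?s)) * K p q (Plus # v)
        = of_nat (?s + 1) * (ind_x * ?K) + smult p (of_nat (?s + 1) * integral_poly ind_x 1 ?K)"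
      unfolding fact integral_poly_of_nat_mult by (simp only: K.simps distrib_left mult_smult_right mult_ac)
    also have "of_nat (?s + 1) * (ind_x * ?K) = (\<Sum>l=1..?s + 1. smult (d l) (of_nat (?s + 1) * (ind_x * B ?s l)))"
      unfolding IH by (simp add: sum_distrib_left del: of_nat_add of_nat_Suc sum.cl_ivl_Suc)
    also have "\<dots> = (\<Sum>l=1..?s + 1. smult (d l) (of_nat l * B (?s + 1) (l + 1)))"
      by (intro sum.cong refl) (simp only: ind_x_mult_bernstein)
    also have "\<dots> = (\<Sum>k=1..?s + 2. smult (of_nat (k - 1) * d (k - 1)) (B (?s + 1) k))"
      by (rule sum.reindex_bij_witness_not_neutral[of "{}" "{1}" _ "\<lambda>k. k - 1" Suc])
         (auto simp: of_nat_poly)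
    also have "of_nat (?s + 1) * integral_poly ind_x 1 ?K
        = (\<Sum>l=1..?s + 1. smult (d l) (of_nat (?s + 1) * integral_poly ind_x 1 (B ?s l)))"
      unfolding IH integral_poly_sum_smult by (simp add: sum_distrib_left del: of_nat_add of_nat_Suc sum.cl_ivl_Suc)
    also have "\<dots> = (\<Sum>l=1..?s + 1. \<Sum>k=1..l. smult (d l) (B (?s + 1) k))"
      by (intro sum.cong refl) (simp only: integral_poly_x_1_bernstein smult_sum_right)
    also have "\<dots> = (\<Sum>k=1..?s + 2. \<Sum>l=k..?s + 1. smult (d l) (B (?s + 1) k))"
    proof -
      have "{1..l} = {k \<in> {1..?s + 2}. k \<le> l}" if "l \<in> {1..?s + 1}" for l
        using that by auto
      then have "(\<Sum>l=1..?s + 1. \<Sum>k=1..l. smult (d l) (B (?s + 1) k))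
          = (\<Sum>l=1..?s + 1. \<Sum>k | k \<in> {1..?s + 2} \<and> k \<le> l. smult (d l) (B (?s + 1) k))"
        by (intro sum.cong) blast+
      also have "\<dots> = (\<Sum>k=1..?s + 2. \<Sum>l | l \<in> {1..?s + 1} \<and> k \<le> l. smult (d l) (B (?s + 1) k))"
        by (rule sum.swap_restrict) simp_all
      also have "\<dots> = (\<Sum>k=1..?s + 2. \<Sum>l=k..?s + 1. smult (d l) (B (?s + 1) k))"
        by (intro sum.cong) auto
      finally show ?thesis .
    qed
    also have "(\<Sum>k=1..?s + 2. smult (of_nat (k - 1) * d (k - 1)) (B (?s + 1) k))
        + smult p (\<Sum>k=1..?s + 2. \<Sum>l=k..?s + 1. smult (d l) (B (?s + 1) k))
      = (\<Sum>k=1..?s + 2. smult (deletion_sum p q (Plus # v) {1..?s + 2} k) (B (?s + 1) k))"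
      unfolding smult_sum_right sum.distrib[symmetric]
    proof (rule sum.cong[OF refl])
      fix k assume k: "k \<in> {1..?s + 2}"
      have "deletion_sum p q (Plus # v) {1..?s + 2} k
          = p * (\<Sum>l=k..?s + 1. d l) + of_nat (k - 1) * d (k - 1)"
        using deletion_sum_Plus[of k "?s + 1" p q v] k unfolding d_def by simp
      then show "smult (of_nat (k - 1) * d (k - 1)) (B (?s + 1) k)
          + (\<Sum>l=k..?s + 1. smult p (smult (d l) (B (?s + 1) k)))
        = smult (deletion_sum p q (Plus # v) {1..?s + 2} k) (B (?s + 1) k)"
        by (simp only: smult_add_left smult_smult smult_sum sum_distrib_left add.commute)
    qed
    finally show ?thesis
      using Plus by simp
  next
    case Minus
    have "of_nat (fact (Suc ?s)) * K p q (Minus # v)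
        = of_nat (?s + 1) * ((1 - ind_x) * ?K) + smult q (of_nat (?s + 1) * integral_poly 0 ind_x ?K)"
      unfolding fact integral_poly_of_nat_mult by (simp only: K.simps distrib_left mult_smult_right mult_ac)
    also have "of_nat (?s + 1) * ((1 - ind_x) * ?K) = (\<Sum>l=1..?s + 1. smult (d l) (of_nat (?s + 1) * ((1 - ind_x) * B ?s l)))"
      unfolding IH by (simp add: sum_distrib_left del: of_nat_add of_nat_Suc sum.cl_ivl_Suc)
    also have "\<dots> = (\<Sum>l=1..?s + 1. smult (d l) (of_nat (?s + 2 - l) * B (?s + 1) l))"
      by (intro sum.cong refl) (simp only: one_minus_ind_x_mult_bernstein)
    also have "\<dots> = (\<Sum>k=1..?s + 2. smult (of_nat (?s + 2 - k) * d k) (B (?s + 1) k))"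
      by (rule sum.reindex_bij_witness_not_neutral[of "{}" "{?s + 2}" _ "\<lambda>k. k" "\<lambda>k. k"])
         (auto simp: of_nat_poly)
    also have "of_nat (?s + 1) * integral_poly 0 ind_x ?K
        = (\<Sum>l=1..?s + 1. smult (d l) (of_nat (?s + 1) * integral_poly 0 ind_x (B ?s l)))"
      unfolding IH integral_poly_sum_smult by (simp add: sum_distrib_left del: of_nat_add of_nat_Suc sum.cl_ivl_Suc)
    also have "\<dots> = (\<Sum>l=1..?s + 1. \<Sum>k=l + 1..?s + 2. smult (d l) (B (?s + 1) k))"
      by (intro sum.cong refl) (simp only: integral_poly_0_x_bernstein smult_sum_right)
    also have "\<dots> = (\<Sum>k=1..?s + 2. \<Sum>l=1..<k. smult (d l) (B (?s + 1) k))"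
    proof -
      have "{l + 1..?s + 2} = {k \<in> {1..?s + 2}. l < k}" for l
        by auto
      then have "(\<Sum>l=1..?s + 1. \<Sum>k=l + 1..?s + 2. smult (d l) (B (?s + 1) k))
          = (\<Sum>l=1..?s + 1. \<Sum>k | k \<in> {1..?s + 2} \<and> l < k. smult (d l) (B (?s + 1) k))"
        by (simp only:)
      also have "\<dots> = (\<Sum>k=1..?s + 2. \<Sum>l | l \<in> {1..?s + 1} \<and> l < k. smult (d l) (B (?s + 1) k))"
        by (rule sum.swap_restrict) simp_all
      also have "\<dots> = (\<Sum>k=1..?s + 2. \<Sum>l=1..<k. smult (d l) (B (?s + 1) k))"
        by (intro sum.cong) auto
      finally show ?thesis .
    qed
    also have "(\<Sum>k=1..?s + 2. smult (of_nat (?s + 2 - k) * d k) (B (?s + 1) k))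
        + smult q (\<Sum>k=1..?s + 2. \<Sum>l=1..<k. smult (d l) (B (?s + 1) k))
      = (\<Sum>k=1..?s + 2. smult (deletion_sum p q (Minus # v) {1..?s + 2} k) (B (?s + 1) k))"
      unfolding smult_sum_right sum.distrib[symmetric]
    proof (rule sum.cong[OF refl])
      fix k assume k: "k \<in> {1..?s + 2}"
      have "deletion_sum p q (Minus # v) {1..?s + 2} k
          = q * (\<Sum>l=1..<k. d l) + of_nat (?s + 2 - k) * d k"
        using deletion_sum_Minus[of k "?s + 1" p q v] k unfolding d_def by simp
      then show "smult (of_nat (?s + 2 - k) * d k) (B (?s + 1) k)
          + (\<Sum>l=1..<k. smult q (smult (d l) (B (?s + 1) k)))
        = smult (deletion_sum p q (Minus # v) {1..?s + 2} k) (B (?s + 1) k)"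
        by (simp only: smult_add_left smult_smult smult_sum sum_distrib_left add.commute)
    qed
    finally show ?thesis
      using Minus by simp
  qed
qed

theorem sum_deletion_sum_eq_integral:
  "(\<Sum>k=1..length w + 1. deletion_sum p q w {1..length w + 1} k)
    = of_nat (fact (length w + 1)) * integral_const 0 1 (K p q w)"
proof -
  let ?r = "length w" and ?d = "deletion_sum p q w {1..length w + 1}"
  have "of_nat (fact (?r + 1)) * integral_const 0 1 (K p q w)
      = of_nat (?r + 1) * integral_const 0 1 (of_nat (fact ?r) * K p q w)"
    unfolding integral_const_of_nat_mult 
    by (simp only: fact_Suc of_nat_mult of_nat_id Suc_eq_plus1[symmetric] mult.assoc)
  also have "\<dots> = (\<Sum>k=1..?r + 1. ?d k * (of_nat (?r + 1) * integral_const 0 1 (B ?r k)))"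
    unfolding K_bernstein_expansion integral_const_sum_smult sum_distrib_left
    by (simp only: mult.left_commute)
  also have "\<dots> = (\<Sum>k=1..?r + 1. ?d k)"
    by (intro sum.cong refl) (simp only: integral_const_bernstein mult_1_right)
  finally show ?thesis ..
qed


section \<open>Order polynomials of fences\<close>

definition fence_maps :: "sign list \<Rightarrow> nat \<Rightarrow> (nat \<Rightarrow> nat) set" where
  "fence_maps \<epsilon> m = {f \<in> {1..length \<epsilon> + 1} \<rightarrow>\<^sub>E {1..m}.
     \<forall>i\<in>{1..length \<epsilon>}. \<not> advances (letter \<epsilon> i) (f i) (f (i + 1))}"

text \<open>
  Monotonicity along the transitive closure is monotonicity along the generating relations.
\<close>

lemma order_preserving_maps_fence:
  "order_preserving_maps (fence_carrier \<epsilon>) (fence_order \<epsilon>) m = fence_maps \<epsilon> m"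
proof -
  have "monotone_on (fence_carrier \<epsilon>) (\<lambda>a b. (a, b) \<in> fence_order \<epsilon>) (\<le>) f \<longleftrightarrow>
    (\<forall>i\<in>{1..length \<epsilon>}. \<not> advances (letter \<epsilon> i) (f i) (f (i + 1)))" for f :: "nat \<Rightarrow> nat"
  proof
    assume mono: "monotone_on (fence_carrier \<epsilon>) (\<lambda>a b. (a, b) \<in> fence_order \<epsilon>) (\<le>) f"
    show "\<forall>i\<in>{1..length \<epsilon>}. \<not> advances (letter \<epsilon> i) (f i) (f (i + 1))"
    proof
      fix i assume i: "i \<in> {1..length \<epsilon>}"
      then have car: "i \<in> fence_carrier \<epsilon>" "i + 1 \<in> fence_carrier \<epsilon>"
        by (auto simp: fence_carrier_def)
      show "\<not> advances (letter \<epsilon> i) (f i) (f (i + 1))"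
      proof (cases "letter \<epsilon> i")
        case Plus
        then have "(i + 1, i) \<in> fence_gen \<epsilon>"
          using i by (auto simp: fence_gen_def)
        then have "(i + 1, i) \<in> fence_order \<epsilon>"
          by (auto simp: fence_order_def)
        then show ?thesis
          using monotone_onD[OF mono car(2,1)] Plus by simp
      next
        case Minus
        then have "(i, i + 1) \<in> fence_gen \<epsilon>"
          using i by (auto simp: fence_gen_def)
        then have "(i, i + 1) \<in> fence_order \<epsilon>"
          by (auto simp: fence_order_def)
        then show ?thesis
          using monotone_onD[OF mono car] Minus by simp
      qed
    qed
  next
    assume adj: "\<forall>i\<in>{1..length \<epsilon>}. \<not> advances (letter \<epsilon> i) (f i) (f (i + 1))"
    have gen: "f a \<le> f b" if ab: "(a, b) \<in> fence_gen \<epsilon>" for a b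
    proof -
      from ab consider
          (plus) "a = b + 1" "b \<in> {1..length \<epsilon>}" "letter \<epsilon> b = Plus"
        | (minus) "b = a + 1" "a \<in> {1..length \<epsilon>}" "letter \<epsilon> a = Minus"
        unfolding fence_gen_def by blast
      then show ?thesis
        using adj by cases fastforce+
    qed
    have trancl: "f a \<le> f b" if "(a, b) \<in> (fence_gen \<epsilon>)\<^sup>+" for a b
      using that by (induction rule: trancl_induct) (use gen order_trans in blast)+
    then show "monotone_on (fence_carrier \<epsilon>) (\<lambda>a b. (a, b) \<in> fence_order \<epsilon>) (\<le>) f"
      by (auto simp: monotone_on_def fence_order_def)
  qed
  then show ?thesis
    unfolding order_preserving_maps_def fence_maps_def fence_carrier_def by blast
qed

text \<open>
  The number of monotone maps of the fence into \<open>[m]\<close> with prescribed value \<open>a\<close> at the last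
  element, where the word is read from that end.
\<close>

fun transfer_count :: "nat \<Rightarrow> sign list \<Rightarrow> nat \<Rightarrow> nat" where
  "transfer_count m [] a = 1"
| "transfer_count m (s # v) a = (\<Sum>b | b \<in> {1..m} \<and> \<not> advances s b a. transfer_count m v b)"

lemma finite_fence_maps: "finite (fence_maps \<epsilon> m)"
proof -
  have "finite ({1..length \<epsilon> + 1} \<rightarrow>\<^sub>E {1..m})"
    by (intro finite_PiE) auto
  then show ?thesis
    unfolding fence_maps_def by (rule finite_subset[rotated]) blast
qed

lemma fence_maps_last_in: "f \<in> fence_maps \<epsilon> m \<Longrightarrow> f (length \<epsilon> + 1) \<in> {1..m}"
  by (rule PiE_mem[of f "{1..length \<epsilon> + 1}" "\<lambda>_. {1..m}"]) (auto simp: fence_maps_def)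

lemma fence_maps_snoc:
  fixes \<epsilon> :: "sign list"
  assumes a: "a \<in> {1..m}"
  defines "n \<equiv> length \<epsilon> + 1"
  shows "bij_betw (\<lambda>f. restrict f {1..n})
    {f \<in> fence_maps (\<epsilon> @ [s]) m. f (n + 1) = a} {f \<in> fence_maps \<epsilon> m. \<not> advances s (f n) a}"
proof (rule bij_betw_byWitness[of _ "\<lambda>f. f(n + 1 := a)"])
  have letters: "letter (\<epsilon> @ [s]) i = (if i = n then s else letter \<epsilon> i)" if "i \<in> {1..n}" for i
    using that by (auto simp: nth_append n_def)
  have dom: "{1..length (\<epsilon> @ [s])} = insert n {1..length \<epsilon>}" "{1..length (\<epsilon> @ [s]) + 1} = insert (n + 1) {1..n}"
    by (auto simp: n_def)
  show "\<forall>f\<in>{f \<in> fence_maps (\<epsilon> @ [s]) m. f (n + 1) = a}. (restrict f {1..n})(n + 1 := a) = f"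
    unfolding fence_maps_def dom by (auto simp: fun_eq_iff PiE_def extensional_def)
  show "\<forall>f\<in>{f \<in> fence_maps \<epsilon> m. \<not> advances s (f n) a}. restrict (f(n + 1 := a)) {1..n} = f"
    unfolding fence_maps_def n_def[symmetric] by (auto simp: fun_eq_iff PiE_def extensional_def)
  show "(\<lambda>f. restrict f {1..n}) ` {f \<in> fence_maps (\<epsilon> @ [s]) m. f (n + 1) = a}
      \<subseteq> {f \<in> fence_maps \<epsilon> m. \<not> advances s (f n) a}"
  proof (intro image_subsetI)
    fix f assume "f \<in> {f \<in> fence_maps (\<epsilon> @ [s]) m. f (n + 1) = a}"
    then have f: "f \<in> insert (n + 1) {1..n} \<rightarrow>\<^sub>E {1..m}" "f (n + 1) = a"
      and adj: "\<And>i. i \<in> {1..n} \<Longrightarrow> \<not> advances (if i = n then s else letter \<epsilon> i) (f i) (f (i + 1))"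
      unfolding fence_maps_def dom(2) using letters by (auto simp: n_def)
    have "\<not> advances (letter \<epsilon> i) (f i) (f (i + 1))" if "i \<in> {1..length \<epsilon>}" for i
      using adj[of i] that by (auto simp: n_def)
    moreover have "\<not> advances s (f n) a"
      using adj[of n] f(2) by (auto simp: n_def)
    ultimately show "restrict f {1..n} \<in> {f \<in> fence_maps \<epsilon> m. \<not> advances s (f n) a}"
      using f unfolding fence_maps_def n_def by (auto simp del: One_nat_def)
  qed
  show "(\<lambda>f. f(n + 1 := a)) ` {f \<in> fence_maps \<epsilon> m. \<not> advances s (f n) a}
      \<subseteq> {f \<in> fence_maps (\<epsilon> @ [s]) m. f (n + 1) = a}"
  proof (intro image_subsetI)
    fix f assume "f \<in> {f \<in> fence_maps \<epsilon> m. \<not> advances s (f n) a}"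
    then have f: "f \<in> {1..n} \<rightarrow>\<^sub>E {1..m}" "\<not> advances s (f n) a"
      and adj: "\<And>i. i \<in> {1..length \<epsilon>} \<Longrightarrow> \<not> advances (letter \<epsilon> i) (f i) (f (i + 1))"
      unfolding fence_maps_def n_def by blast+
    have range: "f(n + 1 := a) \<in> insert (n + 1) {1..n} \<rightarrow>\<^sub>E {1..m}"
      using f(1) a by (intro PiE_fun_upd)
    have steps: "\<not> advances (letter (\<epsilon> @ [s]) i) ((f(n + 1 := a)) i) ((f(n + 1 := a)) (i + 1))"
      if "i \<in> insert n {1..length \<epsilon>}" for i
      using that adj[of i] f(2) letters[of i] by (auto simp: n_def)
    show "f(n + 1 := a) \<in> {f \<in> fence_maps (\<epsilon> @ [s]) m. f (n + 1) = a}"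
      unfolding fence_maps_def dom by (intro CollectI conjI ballI range steps fun_upd_same)
  qed
qed

lemma card_fence_maps_last:
  "a \<in> {1..m} \<Longrightarrow> card {f \<in> fence_maps \<epsilon> m. f (length \<epsilon> + 1) = a} = transfer_count m (rev \<epsilon>) a"
proof (induction \<epsilon> arbitrary: a rule: rev_induct)
  case Nil
  have "{f \<in> fence_maps [] m. f 1 = a} = {\<lambda>i\<in>{1}. a}"
    using Nil by (auto simp: fence_maps_def fun_eq_iff PiE_def extensional_def)
  then show ?case by simp
next
  case (snoc s \<epsilon>)
  let ?n = "length \<epsilon> + 1"
  let ?B = "{b. b \<in> {1..m} \<and> \<not> advances s b a}"
  have "card {f \<in> fence_maps (\<epsilon> @ [s]) m. f (?n + 1) = a} = card {f \<in> fence_maps \<epsilon> m. \<not> advances s (f ?n) a}"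
    by (rule bij_betw_same_card[OF fence_maps_snoc[OF snoc.prems]])
  also have "{f \<in> fence_maps \<epsilon> m. \<not> advances s (f ?n) a} = (\<Union>b\<in>?B. {f \<in> fence_maps \<epsilon> m. f ?n = b})"
    using fence_maps_last_in by blast
  also have "card \<dots> = (\<Sum>b\<in>?B. card {f \<in> fence_maps \<epsilon> m. f ?n = b})"
    by (rule card_UN_disjoint) (auto simp: finite_fence_maps)
  also have "\<dots> = (\<Sum>b\<in>?B. transfer_count m (rev \<epsilon>) b)"
    by (intro sum.cong refl snoc.IH) auto
  finally show ?case by simp
qed

lemma card_fence_maps: "card (fence_maps \<epsilon> m) = (\<Sum>a=1..m. transfer_count m (rev \<epsilon>) a)"
proof -
  have "fence_maps \<epsilon> m = (\<Union>a\<in>{1..m}. {f \<in> fence_maps \<epsilon> m. f (length \<epsilon> + 1) = a})"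
    using fence_maps_last_in by blast
  then have "card (fence_maps \<epsilon> m) = card (\<Union>a\<in>{1..m}. {f \<in> fence_maps \<epsilon> m. f (length \<epsilon> + 1) = a})"
    by simp
  also have "\<dots> = (\<Sum>a=1..m. card {f \<in> fence_maps \<epsilon> m. f (length \<epsilon> + 1) = a})"
    by (rule card_UN_disjoint) (auto simp: finite_fence_maps)
  also have "\<dots> = (\<Sum>a=1..m. transfer_count m (rev \<epsilon>) a)"
    by (intro sum.cong refl card_fence_maps_last)
  finally show ?thesis .
qed

text \<open>
  The polynomials \<open>binomial(t - 1, j)\<close> and, below, \<open>binomial(t, j + 1)\<close>; the latter is the sum of
  \<open>binomial(b - 1, j)\<close> over \<open>b = 1, \<dots>, t\<close>.
\<close>

fun binomial_pred :: "nat \<Rightarrow> rat poly" where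
  "binomial_pred 0 = 1"
| "binomial_pred (Suc j) = smult (1 / of_nat (Suc j)) ((ind_t - of_nat (Suc j)) * binomial_pred j)"

definition binomial_sum :: "nat \<Rightarrow> rat poly" where
  "binomial_sum j = smult (1 / of_nat (Suc j)) (ind_t * binomial_pred j)"

lemma binomial_pred_Suc_eq: "binomial_pred (Suc j) = binomial_sum j - binomial_pred j"
proof -
  have "smult (1 / of_nat (Suc j)) (of_nat (Suc j) * g) = g" for g :: "rat poly"
    by (simp add: of_nat_poly del: of_nat_Suc)
  then show ?thesis
    by (simp add: binomial_sum_def left_diff_distrib smult_diff_right del: of_nat_Suc)
qed

lemma poly_binomial_pred: "poly (binomial_pred j) (of_nat (Suc m)) = of_nat (m choose j)"
proof (induction j)
  case (Suc j)
  have "(of_nat m - of_nat j) * (of_nat m gchoose j) = of_nat (Suc j) * (of_nat m gchoose Suc j :: rat)"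
    using gbinomial_mult_1[of "of_nat m :: rat" j] by (simp add: left_diff_distrib)
  then show ?case
    using Suc by (simp add: ind_t_def binomial_gbinomial divide_eq_eq ac_simps del: binomial_gbinomial[symmetric])
qed simp

lemma poly_binomial_sum: 
  assumes "m \<ge> 1"
  shows "poly (binomial_sum j) (of_nat m) = of_nat (m choose Suc j)"
proof -
  obtain n where m: "m = Suc n" using assms by (cases m) auto
  have "of_nat (Suc j) * of_nat (Suc n choose Suc j) = (of_nat (Suc n) * of_nat (n choose j) :: rat)"
    unfolding of_nat_mult[symmetric] Suc_times_binomial_eq by (simp only: mult.commute)
  then show ?thesis
    by (simp add: binomial_sum_def m poly_binomial_pred ind_t_def field_simps del: of_nat_Suc binomial_Suc_Suc)
qed

text \<open>
  Coefficients, polynomial in \<open>t = m\<close>, of \<open>a \<mapsto> transfer_count m w a\<close> in the Newton basis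
  \<open>binomial(a - 1, j)\<close>. Summing this basis over \<open>b \<le> a\<close> shifts \<open>j\<close> by one and uses Pascal's rule;
  summing over \<open>b \<ge> a\<close> gives the total minus such a partial sum.
\<close>

fun newton_coeff :: "sign list \<Rightarrow> nat \<Rightarrow> rat poly" where
  "newton_coeff [] j = (if j = 0 then 1 else 0)"
| "newton_coeff (Plus # v) 0 = (\<Sum>i\<le>length v. newton_coeff v i * binomial_sum i)"
| "newton_coeff (Plus # v) (Suc j) = - newton_coeff v j"
| "newton_coeff (Minus # v) 0 = newton_coeff v 0"
| "newton_coeff (Minus # v) (Suc j) = newton_coeff v j + newton_coeff v (Suc j)"

lemma newton_coeff_eq_0: "j > length w \<Longrightarrow> newton_coeff w j = 0"
  by (induction w j rule: newton_coeff.induct) auto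

lemma sum_choose_pred: "(\<Sum>b=1..a. (b - 1) choose j) = a choose Suc j"
  by (induction a) auto

lemma transfer_count_eq_newton:
  assumes "a \<in> {1..m}"
  shows "of_nat (transfer_count m w a) =
    (\<Sum>j\<le>length w. poly (newton_coeff w j) (of_nat m) * of_nat ((a - 1) choose j))"
  using assms
proof (induction w arbitrary: a)
  case (Cons s v)
  let ?c = "\<lambda>j. poly (newton_coeff v j) (of_nat m)" and ?L = "length v"
  have m: "m \<ge> 1" using Cons.prems by simp
  have count: "of_nat (transfer_count m (s # v) a) =
      (\<Sum>j\<le>?L. ?c j * of_nat (\<Sum>b | b \<in> {1..m} \<and> \<not> advances s b a. (b - 1) choose j))"
  proof -
    have "of_nat (transfer_count m (s # v) a) = (\<Sum>b | b \<in> {1..m} \<and> \<not> advances s b a.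
        \<Sum>j\<le>?L. ?c j * of_nat ((b - 1) choose j))"
      unfolding transfer_count.simps of_nat_sum by (intro sum.cong refl Cons.IH) auto
    then show ?thesis
      by (simp add: sum_distrib_left sum.swap[of _ _ "{..?L}"])
  qed
  have shift: "(\<Sum>j\<le>length (s # v). f j) = f 0 + (\<Sum>j\<le>?L. f (Suc j))" for f :: "nat \<Rightarrow> rat"
    by (simp add: sum.atMost_Suc_shift del: sum.atMost_Suc)
  show ?case
  proof (cases s)
    case Plus
    have "(\<Sum>b | b \<in> {1..m} \<and> \<not> advances s b a. (b - 1) choose j) + ((a - 1) choose Suc j) = m choose Suc j" for j
    proof -
      have ge: "{b. b \<in> {1..m} \<and> \<not> advances s b a} = {a..m}"
        using Plus Cons.prems by auto
      have "{1..m} = {1..a - 1} \<union> {a..m}"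
        using Cons.prems by auto
      then have "(\<Sum>b=1..m. (b - 1) choose j) = (\<Sum>b=1..a - 1. (b - 1) choose j) + (\<Sum>b=a..m. (b - 1) choose j)"
        using sum.union_disjoint[of "{1..a - 1}" "{a..m}" "\<lambda>b. (b - 1) choose j"] Cons.prems by auto
      then show ?thesis
        unfolding ge sum_choose_pred by (rule trans[OF add.commute sym])
    qed
    then have X: "(of_nat (\<Sum>b | b \<in> {1..m} \<and> \<not> advances s b a. (b - 1) choose j) :: rat)
        = of_nat (m choose Suc j) - of_nat ((a - 1) choose Suc j)" for j
      unfolding eq_diff_eq of_nat_add[symmetric] by (rule arg_cong)
    show ?thesis
      unfolding count shift X using Plus m
      by (simp add: poly_sum poly_binomial_sum right_diff_distrib sum_subtractf sum_negf)
  next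
    case Minus
    have pascal: "a choose Suc j = ((a - 1) choose j) + ((a - 1) choose Suc j)" for j
      using Cons.prems by (cases a) simp_all
    have le: "{b. b \<in> {1..m} \<and> \<not> advances s b a} = {1..a}"
      using Minus Cons.prems by auto
    have "of_nat (transfer_count m (s # v) a) = (\<Sum>j\<le>?L. ?c j * of_nat ((a - 1) choose j))
        + (\<Sum>j\<le>?L. ?c j * of_nat ((a - 1) choose Suc j))"
      unfolding count le sum_choose_pred pascal of_nat_add distrib_left sum.distrib ..
    also have "(\<Sum>j\<le>?L. ?c j * of_nat ((a - 1) choose j)) = (\<Sum>j\<le>Suc ?L. ?c j * of_nat ((a - 1) choose j))"
      by (simp add: newton_coeff_eq_0)
    also have "\<dots> = ?c 0 + (\<Sum>j\<le>?L. ?c (Suc j) * of_nat ((a - 1) choose Suc j))"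
      by (simp add: sum.atMost_Suc_shift del: sum.atMost_Suc binomial_Suc_Suc)
    finally show ?thesis
      unfolding shift using Minus by (simp add: distrib_right sum.distrib)
  qed
qed simp

definition fence_polynomial :: "sign list \<Rightarrow> rat poly" where
  "fence_polynomial w = (\<Sum>j\<le>length w. newton_coeff w j * binomial_sum j)"

lemma poly_fence_polynomial:
  assumes "m \<ge> 1"
  shows "poly (fence_polynomial (rev \<epsilon>)) (of_nat m) = of_nat (card (fence_maps \<epsilon> m))"
proof -
  have "of_nat (card (fence_maps \<epsilon> m)) = (\<Sum>a=1..m. \<Sum>j\<le>length \<epsilon>.
      poly (newton_coeff (rev \<epsilon>) j) (of_nat m) * of_nat ((a - 1) choose j))"
    unfolding card_fence_maps of_nat_sum
    by (intro sum.cong refl) (use transfer_count_eq_newton[of _ m "rev \<epsilon>"] in simp)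
  also have "\<dots> = (\<Sum>j\<le>length \<epsilon>. poly (newton_coeff (rev \<epsilon>) j) (of_nat m) * of_nat (m choose Suc j))"
    unfolding sum_choose_pred[symmetric] of_nat_sum sum_distrib_left by (rule sum.swap)
  finally show ?thesis
    using assms by (simp add: fence_polynomial_def poly_sum poly_binomial_sum)
qed

text \<open>
  The polynomial takes the right value at every positive integer, and two polynomials that
  agree at infinitely many points are equal, so the definite description denotes it.
\<close>

lemma order_polynomial_fence:
  "order_polynomial (fence_carrier \<epsilon>) (fence_order \<epsilon>) = fence_polynomial (rev \<epsilon>)"
  unfolding order_polynomial_def
proof (rule the_equality)
  show "\<forall>m\<ge>1. poly (fence_polynomial (rev \<epsilon>)) (of_nat m)
      = of_nat (card (order_preserving_maps (fence_carrier \<epsilon>) (fence_order \<epsilon>) m))"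
    by (simp add: order_preserving_maps_fence poly_fence_polynomial)
next
  fix P :: "rat poly"
  assume P: "\<forall>m\<ge>1. poly P (of_nat m)
      = of_nat (card (order_preserving_maps (fence_carrier \<epsilon>) (fence_order \<epsilon>) m))"
  show "P = fence_polynomial (rev \<epsilon>)"
  proof (rule ccontr)
    assume "P \<noteq> fence_polynomial (rev \<epsilon>)"
    then have fin: "finite {x. poly (P - fence_polynomial (rev \<epsilon>)) x = 0}"
      by (intro poly_roots_finite) simp
    have "of_nat ` {1..} \<subseteq> {x. poly (P - fence_polynomial (rev \<epsilon>)) x = 0}"
      using P by (auto simp: order_preserving_maps_fence poly_fence_polynomial)
    then have "finite (of_nat ` {1::nat..} :: rat set)"
      using fin by (rule finite_subset)
    then have "finite {1::nat..}"
      by (rule finite_imageD) (simp add: inj_on_def)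
    then show False
      by (simp add: infinite_Ici)
  qed
qed

lemma integral_const_0_1_sum:
  assumes "degree f \<le> N"
  shows "integral_const 0 1 f = (\<Sum>i\<le>N. smult [:1 / of_nat (Suc i):] (coeff f i))"
proof -
  have "integral_const 0 1 f = (\<Sum>i\<le>degree f. smult [:1 / of_nat (Suc i):] (coeff f i))"
    unfolding integral_const_0_1 by (simp add: antideriv_def poly_sum poly_monom)
  also have "\<dots> = (\<Sum>i\<le>N. smult [:1 / of_nat (Suc i):] (coeff f i))"
    using assms by (intro sum.mono_neutral_left) (auto simp: coeff_eq_0)
  finally show ?thesis .
qed

text \<open>
  Since \<open>t / (j + 1) * binomial(t - 1, j) = binomial(t, j + 1)\<close>, integrating over \<open>[0, 1]\<close> and
  multiplying by \<open>t\<close> corresponds to summing the Newton expansion over all values \<open>a\<close>.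
\<close>

lemma integral_const_of_newton_coeffs:
  assumes "\<And>j. coeff f j = [:newton_coeff v j * binomial_pred j:]"
  shows "[:ind_t:] * integral_const 0 1 f = [:\<Sum>j\<le>length v. newton_coeff v j * binomial_sum j:]"
proof -
  have deg: "degree f \<le> length v"
    by (rule degree_le) (simp add: assms newton_coeff_eq_0)
  have "[:ind_t:] * integral_const 0 1 f
      = (\<Sum>i\<le>length v. [:ind_t:] * smult [:1 / of_nat (Suc i):] [:newton_coeff v i * binomial_pred i:])"
    unfolding integral_const_0_1_sum[OF deg] assms sum_distrib_left ..
  also have "\<dots> = (\<Sum>i\<le>length v. [:newton_coeff v i * binomial_sum i:])"
    by (intro sum.cong refl) (simp add: binomial_sum_def ac_simps del: of_nat_Suc)
  finally show ?thesis
    by (simp only: sum_to_poly)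
qed

lemma ind_x_mult: "ind_x * f = pCons 0 f"
  by (simp add: ind_x_def)

text \<open>
  The link between the discrete and the continuous recursion: replacing \<open>binomial(a - 1, j)\<close> by
  \<open>binomial(t - 1, j) x ^ j\<close> turns the transfer sums into the integral operators with \<open>p = q = t\<close>.
  It is the identity \<open>binomial(t - 1, j + 1) = t / (j + 1) * binomial(t - 1, j) - binomial(t - 1, j)\<close>
  that matches a coefficient of \<open>x\<close> times a polynomial and of its antiderivative with the shift
  of the Newton coefficients.
\<close>

lemma coeff_K_diagonal:
  "coeff (K [:ind_t:] [:ind_t:] w) j = [:newton_coeff w j * binomial_pred j:]"
proof (induction w arbitrary: j)
  case Nil
  then show ?case by (cases j) (simp_all add: one_pCons)
next
  case (Cons s v)
  let ?f = "K [:ind_t:] [:ind_t:] v"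
  have int: "[:ind_t:] * smult [:1 / of_nat (Suc i):] (coeff ?f i) = [:newton_coeff v i * binomial_sum i:]" for i
    by (simp add: Cons binomial_sum_def ac_simps del: of_nat_Suc)
  show ?case
  proof (cases s; cases j)
    fix i assume *: "s = Plus" "j = Suc i"
    have "coeff (K [:ind_t:] [:ind_t:] (s # v)) j
        = coeff ?f i - [:ind_t:] * smult [:1 / of_nat (Suc i):] (coeff ?f i)"
      using * by (simp add: integral_poly_x_1 ind_x_mult del: of_nat_Suc)
    also have "\<dots> = [:- newton_coeff v i * binomial_pred (Suc i):]"
      unfolding int binomial_pred_Suc_eq by (simp add: Cons algebra_simps)
    finally show ?thesis
      using * by (simp del: binomial_pred.simps)
  next
    fix i assume *: "s = Minus" "j = Suc i"
    have "coeff (K [:ind_t:] [:ind_t:] (s # v)) j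
        = coeff ?f (Suc i) - coeff ?f i + [:ind_t:] * smult [:1 / of_nat (Suc i):] (coeff ?f i)"
      using * by (simp add: integral_poly_0_x ind_x_mult left_diff_distrib del: of_nat_Suc)
    also have "\<dots> = [:(newton_coeff v i + newton_coeff v (Suc i)) * binomial_pred (Suc i):]"
      unfolding int by (simp add: Cons binomial_pred_Suc_eq algebra_simps del: binomial_pred.simps)
    finally show ?thesis
      using * by (simp del: binomial_pred.simps)
  next
    assume "s = Plus" "j = 0"
    then show ?thesis
      using integral_const_of_newton_coeffs[of ?f v] Cons by (simp add: integral_poly_x_1 ind_x_mult)
  next
    assume "s = Minus" "j = 0"
    then show ?thesis
      by (simp add: integral_poly_0_x ind_x_mult left_diff_distrib Cons)
  qed
qed

text \<open>
  Here \<open>p = q = t\<close> is specialised inside \<open>\<rat>[p,q]\<close>, with \<open>t\<close> as a constant of the outer polynomial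
  ring; this transports the result back to \<open>\<rat>[t]\<close>.
\<close>

lemma deletion_sum_const:
  "deletion_sum [:p:] [:q:] w A k = [:deletion_sum p q w A k:]"
proof (induction w arbitrary: A k)
  case (Cons a v)
  have "sign_weight [:p:] [:q:] a = [:sign_weight p q a:]"
    by (cases a) simp_all
  then show ?case by (simp add: Cons sum_to_poly mult.commute)
qed (simp add: one_pCons)

theorem order_polynomial_eq_deletion_sum:
  assumes "w = rev \<epsilon>"
  shows "of_nat (fact (length \<epsilon> + 1)) * order_polynomial (fence_carrier \<epsilon>) (fence_order \<epsilon>)
    = ind_t * (\<Sum>k=1..length \<epsilon> + 1. deletion_sum ind_t ind_t w {1..length \<epsilon> + 1} k)"
proof -
  have "[:of_nat (fact (length \<epsilon> + 1)) * fence_polynomial w:]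
      = of_nat (fact (length w + 1)) * ([:ind_t:] * integral_const 0 1 (K [:ind_t:] [:ind_t:] w))"
    unfolding integral_const_of_newton_coeffs[OF coeff_K_diagonal] fence_polynomial_def
    using assms by (simp add: of_nat_poly del: of_nat_Suc fact_Suc)
  also have "\<dots> = [:ind_t:] * (of_nat (fact (length w + 1)) * integral_const 0 1 (K [:ind_t:] [:ind_t:] w))"
    by (rule mult.left_commute)
  also have "\<dots> = [:ind_t:] * [:\<Sum>k=1..length w + 1. deletion_sum ind_t ind_t w {1..length w + 1} k:]"
    unfolding sum_deletion_sum_eq_integral[symmetric] deletion_sum_const sum_to_poly ..
  finally show ?thesis
    unfolding order_polynomial_fence using assms by simp
qed


section \<open>The expansion and its consequences\<close>

theorem theorem7p1:
  fixes r :: nat and w :: "sign list"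
  assumes "length w = r"
  shows "of_nat (fact r) * K ind_p ind_q w
           = (\<Sum>k=1..r + 1. smult (R ind_p ind_q w k) (bernstein r k))
    \<and> (\<forall>(n::nat) (\<epsilon>::sign list). n = r + 1 \<and> length \<epsilon> = n - 1 \<and> w = rev \<epsilon> \<longrightarrow>
         (\<Sum>\<pi> | \<pi> permutes {1..n}.
             ind_p ^ greedy_records Plus \<epsilon> \<pi> * ind_q ^ greedy_records Minus \<epsilon> \<pi>)
           = (\<Sum>k=1..n. R ind_p ind_q w k)
       \<and> (\<Sum>k=1..n. R ind_p ind_q w k)
           = of_nat (fact n) * integral_const 0 1 (K ind_p ind_q w)
       \<and> of_nat (fact n) * order_polynomial (fence_carrier \<epsilon>) (fence_order \<epsilon>)
           = ind_t * (\<Sum>k=1..n. R ind_t ind_t w k))"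
proof -
  have R: "(\<Sum>k=1..r + 1. R p q w k) = (\<Sum>k=1..r + 1. deletion_sum p q w {1..r + 1} k)"
    for p q :: "'a::comm_semiring_1"
    using R_eq_deletion_sum[of _ w p q] assms by (intro sum.cong) simp_all
  have "of_nat (fact r) * K ind_p ind_q w
      = (\<Sum>k=1..r + 1. smult (R ind_p ind_q w k) (bernstein r k))"
    using K_bernstein_expansion[of w ind_p ind_q] R_eq_deletion_sum[of _ w ind_p ind_q] assms
    by simp
  moreover have "(\<Sum>\<pi> | \<pi> permutes {1..r + 1}.
        ind_p ^ greedy_records Plus \<epsilon> \<pi> * ind_q ^ greedy_records Minus \<epsilon> \<pi>)
      = (\<Sum>k=1..r + 1. R ind_p ind_q w k)" if "w = rev \<epsilon>" for \<epsilon>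
    unfolding R using sum_greedy_records[where p = ind_p and q = ind_q and \<epsilon> = \<epsilon>] that assms by simp
  moreover have "(\<Sum>k=1..r + 1. R ind_p ind_q w k)
      = of_nat (fact (r + 1)) * integral_const 0 1 (K ind_p ind_q w)"
    unfolding R using sum_deletion_sum_eq_integral[of ind_p ind_q w] assms by blast
  moreover have "of_nat (fact (r + 1)) * order_polynomial (fence_carrier \<epsilon>) (fence_order \<epsilon>)
      = ind_t * (\<Sum>k=1..r + 1. R ind_t ind_t w k)" if "w = rev \<epsilon>" for \<epsilon>
    unfolding R using order_polynomial_eq_deletion_sum[OF that] that assms by auto
  ultimately show ?thesis
    by blast
qed

end
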